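(* Let $\alpha\in[0,1)$ and $\tau=\frac{\sqrt{1-\alpha}}{L}\gamma$ for $\gamma\in(0,1)$. Let the iterates be generated by Mirror-Prox with variance reduction (described in the context) with inner-loop length $K$. Then, for $\mathbf z^{S}=\frac{1}{KS}\sum_{s=0}^{S-1}\sum_{k=0}^{K-1}\mathbf z_{k+1/2}^s$, it follows that $$\mathbb E\left[\mathrm{Gap}(\mathbf z^{S})\right]\le\frac{1}{\tau KS}\left(1+\Bigl(1+\frac{8\gamma^2}{1-\gamma^2}\Bigr)\bigl(\alpha+K(1-\alpha)\bigr)\right)\max_{\mathbf z\in\mathcal C}D(\mathbf z,\mathbf z_0).$$
   Context: Let $\mathcal Z$ be a normed vector space with dual space $\mathcal Z^*$, primal-dual norm pair $\|\cdot\|$ and $\|\cdot\|_*$, and duality pairing $\langle\cdot,\cdot\rangle$. Let $g:\mathcal Z\to\mathbb R\cup\{+\infty\}$ be proper convex lower semicontinuous with domain $\operatorname{dom} g=\{\mathbf z:g(\mathbf z)<+\infty\}$. Let $h:\mathcal Z\to\mathbb R\cup\{+\infty\}$ be a proper convex lower semicontinuous function such that (i) $\operatorname{dom} g\subseteq\operatorname{dom} h$, (ii) $h$ is differentiable over $\operatorname{dom}\partial h$, (iii) $h$ is $1$-strongly convex on $\operatorname{dom} g$ (with respect to $\|\cdot\|$). The Bregman distance $D:\operatorname{dom} g\times\operatorname{dom}\partial h\to\mathbb R_+$ associated with $h$ is $D(\mathbf u,\mathbf v)=h(\mathbf u)-h(\mathbf v)-\langle\nabla h(\mathbf v),\mathbf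 u-\mathbf v\rangle$. Problem: find $\mathbf z_*\in\mathcal Z$ with $\langle F(\mathbf z_* ),\mathbf z-\mathbf z_*\rangle+g(\mathbf z)-g(\mathbf z_* )\ge0$ for all $\mathbf z\in\mathcal Z$. The set of solutions is nonempty, and $F:\operatorname{dom} g\to\mathcal Z^*$ is monotone: $\langle F(\mathbf x)-F(\mathbf y),\mathbf x-\mathbf y\rangle\ge0$ for all $\mathbf x,\mathbf y$. $F$ has a stochastic oracle $F_\xi$ that is variable $L$-Lipschitz in mean: for any $\mathbf u,\mathbf v\in\operatorname{dom} g$ there exists a distribution $Q_{\mathbf u,\mathbf v}$ such that $F(\mathbf z)=\mathbb E_{\xi\sim Q_{\mathbf u,\mathbf v}}[F_\xi(\mathbf z)]$ for all $\mathbf z\in\operatorname{dom} g$, and $\mathbb E_{\xi\sim Q_{\mathbf u,\mathbf v}}\left[\|F_\xi(\mathbf u)-F_\xi(\mathbf v)\|_*^2\right]\le L^2\|\mathbf u-\mathbf v\|^2$ (the constant $L$ is the same for all $\mathbf u,\mathbf v$). Mirror-Prox with variance reduction: given a step size $\tau$, a parameter $\alpha$, a positive integer $K$ and a point $\mathbf z_0$, set $\mathbf z_j^{-1}=\mathbf z_0^0=\mathbf w^0=\bar{\mathbf w}^0=\mathbf z_0$ for $j=1,\dots,K$. For $s=0,1,\dots$: for $k=0,\dots,K-1$: $\mathbf z_{k+1/2}^s=\operatorname{argmin}_{\mathbf z}\{g(\mathbf z)+\langle F(\mathbf w^s),\mathbf z\rangle+\frac{\alpha}{\tau}D(\mathbf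 z,\mathbf z_k^s)+\frac{1-\alpha}{\tau}D(\mathbf z,\bar{\mathbf w}^s)\}$; fix the distribution $Q_{\mathbf z_{k+1/2}^s,\mathbf w^s}$ and sample $\xi_k^s$ according to it; $\widehat F(\mathbf z_{k+1/2}^s)=F(\mathbf w^s)+F_{\xi_k^s}(\mathbf z_{k+1/2}^s)-F_{\xi_k^s}(\mathbf w^s)$; $\mathbf z_{k+1}^s=\operatorname{argmin}_{\mathbf z}\{g(\mathbf z)+\langle\widehat F(\mathbf z_{k+1/2}^s),\mathbf z\rangle+\frac{\alpha}{\tau}D(\mathbf z,\mathbf z_k^s)+\frac{1-\alpha}{\tau}D(\mathbf z,\bar{\mathbf w}^s)\}$. After the inner loop: $\mathbf w^{s+1}=\frac1K\sum_{k=1}^K\mathbf z_k^s$; $\bar{\mathbf w}^{s+1}$ is defined by $\nabla h(\bar{\mathbf w}^{s+1})=\frac1K\sum_{k=1}^K\nabla h(\mathbf z_k^s)$; $\mathbf z_0^{s+1}=\mathbf z_K^s$. Gap function: $\mathrm{Gap}(\mathbf w)=\max_{\mathbf z\in\mathcal C}\{\langle F(\mathbf z),\mathbf w-\mathbf z\rangle+g(\mathbf w)-g(\mathbf z)\}$, where $\mathcal C$ is a compact subset of $\mathcal Z$ (used to handle the possibility that $\operatorname{dom} g$ is unbounded). *)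

theory Defs
  imports "HOL-Probability.Probability"
begin

subsection \<open>Extended-real-valued convex functions\<close>

definition eff_dom :: "('a \<Rightarrow> ereal) \<Rightarrow> 'a set" where
  "eff_dom f = {x. f x < \<infinity>}"

definition proper_fun :: "('a \<Rightarrow> ereal) \<Rightarrow> bool" where
  "proper_fun f \<longleftrightarrow> (\<forall>x. f x \<noteq> -\<infinity>) \<and> eff_dom f \<noteq> {}"

definition convex_fun :: "('a::real_vector \<Rightarrow> ereal) \<Rightarrow> bool" where
  "convex_fun f \<longleftrightarrow>
     (\<forall>x y. \<forall>t\<in>{0..1::real}.
        f ((1 - t) *\<^sub>R x + t *\<^sub>R y) \<le> ereal (1 - t) * f x + ereal t * f y)"

definition lsc_fun :: "('a::topological_space \<Rightarrow> ereal) \<Rightarrow> bool" where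
  "lsc_fun f \<longleftrightarrow> (\<forall>x c. c < f x \<longrightarrow> (\<forall>\<^sub>F y in nhds x. c < f y))"

definition strongly_convex_on ::
  "real \<Rightarrow> 'a::real_normed_vector set \<Rightarrow> ('a \<Rightarrow> ereal) \<Rightarrow> bool" where
  "strongly_convex_on \<mu> A f \<longleftrightarrow>
     (\<forall>x\<in>A. \<forall>y\<in>A. \<forall>t\<in>{0..1::real}.
        f ((1 - t) *\<^sub>R x + t *\<^sub>R y) + ereal (\<mu> / 2 * t * (1 - t) * (norm (x - y))\<^sup>2)
          \<le> ereal (1 - t) * f x + ereal t * f y)"

text \<open>The dual space is the type of bounded linear functionals; its operator norm is the dual
  norm, and the pairing of \<open>p\<close> with \<open>x\<close> is \<open>blinfun_apply p x\<close>.\<close>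

definition subdifferential ::
  "('a::real_normed_vector \<Rightarrow> ereal) \<Rightarrow> 'a \<Rightarrow> ('a \<Rightarrow>\<^sub>L real) set" where
  "subdifferential f x =
     {p. x \<in> eff_dom f \<and> (\<forall>y. f x + ereal (blinfun_apply p (y - x)) \<le> f y)}"

definition dom_subdiff :: "('a::real_normed_vector \<Rightarrow> ereal) \<Rightarrow> 'a set" where
  "dom_subdiff f = {x. subdifferential f x \<noteq> {}}"

text \<open>Differentiability is understood in the sense of Gateaux: it is implied by Frechet
  differentiability, with the same gradient, and for convex functions on a finite-dimensional
  space the two notions coincide.\<close>

definition has_gradient ::
  "('a::real_normed_vector \<Rightarrow> ereal) \<Rightarrow> ('a \<Rightarrow>\<^sub>L real) \<Rightarrow> 'a \<Rightarrow> bool" where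
  "has_gradient f p x \<longleftrightarrow>
     (\<forall>d. (\<forall>\<^sub>F t in nhds (0::real). \<bar>f (x + t *\<^sub>R d)\<bar> \<noteq> \<infinity>) \<and>
          ((\<lambda>t. real_of_ereal (f (x + t *\<^sub>R d))) has_real_derivative blinfun_apply p d) (at 0))"

definition gradient :: "('a::real_normed_vector \<Rightarrow> ereal) \<Rightarrow> 'a \<Rightarrow> ('a \<Rightarrow>\<^sub>L real)" where
  "gradient f x = (THE p. has_gradient f p x)"

definition bregman :: "('a::real_normed_vector \<Rightarrow> ereal) \<Rightarrow> 'a \<Rightarrow> 'a \<Rightarrow> ereal" where
  "bregman h u v = h u - h v - ereal (blinfun_apply (gradient h v) (u - v))"


subsection \<open>Variational inequality and gap function\<close>

text \<open>An operator defined on \<open>eff_dom g\<close> is modelled by a total function of which only the values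
  on \<open>eff_dom g\<close> are ever constrained or used.\<close>

definition monotone_operator_on ::
  "'a::real_normed_vector set \<Rightarrow> ('a \<Rightarrow> ('a \<Rightarrow>\<^sub>L real)) \<Rightarrow> bool" where
  "monotone_operator_on A F \<longleftrightarrow>
     (\<forall>x\<in>A. \<forall>y\<in>A. 0 \<le> blinfun_apply (F x - F y) (x - y))"

definition vi_solutions ::
  "('a::real_normed_vector \<Rightarrow> ('a \<Rightarrow>\<^sub>L real)) \<Rightarrow> ('a \<Rightarrow> ereal) \<Rightarrow> 'a set" where
  "vi_solutions F g =
     {x \<in> eff_dom g. \<forall>z. 0 \<le> ereal (blinfun_apply (F x) (z - x)) + g z - g x}"

text \<open>The supremum runs over \<open>C \<inter> eff_dom g\<close>, where \<open>F\<close> is defined; elsewhere the term \<open>- g z\<close>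
  is \<open>-\<infinity>\<close>.\<close>

definition gap ::
  "('a::real_normed_vector \<Rightarrow> ('a \<Rightarrow>\<^sub>L real)) \<Rightarrow> ('a \<Rightarrow> ereal) \<Rightarrow> 'a set \<Rightarrow> 'a \<Rightarrow> ereal" where
  "gap F g C w =
     (SUP z\<in>C \<inter> eff_dom g. ereal (blinfun_apply (F z) (w - z)) + g w - g z)"


subsection \<open>Probabilistic notions\<close>

text \<open>Random vectors in a normed space that need not be separable are Borel measurable functions
  with separable range. On a separable space this is plain Borel measurability.\<close>

definition strongly_measurable :: "'w measure \<Rightarrow> ('w \<Rightarrow> 'a::real_normed_vector) \<Rightarrow> bool" where
  "strongly_measurable M f \<longleftrightarrow>
     f \<in> borel_measurable M \<and> (\<exists>D. countable D \<and> f ` space M \<subseteq> closure D)"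

text \<open>Expectation of a random functional in the weak-star sense, that is, through the duality
  pairing. A Bochner expectation is in particular of this kind; the library's Bochner integral is
  restricted to second-countable spaces, which duals in general are not.\<close>

definition has_dual_expectation ::
  "'x measure \<Rightarrow> ('x \<Rightarrow> ('a::real_normed_vector \<Rightarrow>\<^sub>L real)) \<Rightarrow> ('a \<Rightarrow>\<^sub>L real) \<Rightarrow> bool" where
  "has_dual_expectation Q Y m \<longleftrightarrow>
     (\<forall>d. has_bochner_integral Q (\<lambda>x. blinfun_apply (Y x) d) (blinfun_apply m d))"

text \<open>Expectation of an extended-real random variable. Since \<open>\<infinity> - \<infinity> = \<infinity>\<close> in \<^typ>\<open>ereal\<close>, an upper
  bound below \<open>\<infinity>\<close> includes integrability of the positive part.\<close>

definition ereal_expectation :: "'w measure \<Rightarrow> ('w \<Rightarrow> ereal) \<Rightarrow> ereal" where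
  "ereal_expectation M X =
     enn2ereal (\<integral>\<^sup>+\<omega>. e2ennreal (X \<omega>) \<partial>M) - enn2ereal (\<integral>\<^sup>+\<omega>. e2ennreal (- X \<omega>) \<partial>M)"

text \<open>The random element \<open>X\<close> of \<open>N\<close> is sampled according to the random distribution \<open>\<kappa>\<close>, given the
  information in the sub-sigma-algebra \<open>G\<close>.\<close>

definition sampled_from ::
  "'w measure \<Rightarrow> 'w measure \<Rightarrow> 'x measure \<Rightarrow> ('w \<Rightarrow> 'x) \<Rightarrow> ('w \<Rightarrow> 'x measure) \<Rightarrow> bool" where
  "sampled_from M G N X \<kappa> \<longleftrightarrow>
     X \<in> M \<rightarrow>\<^sub>M N \<and> \<kappa> \<in> G \<rightarrow>\<^sub>M prob_algebra N \<and>
     (\<forall>B\<in>sets G. \<forall>A\<in>sets N.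
        emeasure M (B \<inter> (X -` A \<inter> space M)) = (\<integral>\<^sup>+\<omega>\<in>B. emeasure (\<kappa> \<omega>) A \<partial>M))"

definition variable_lipschitz_oracle ::
  "real \<Rightarrow> 'a::real_normed_vector set \<Rightarrow> 'x measure \<Rightarrow> ('a \<Rightarrow> 'a \<Rightarrow> 'x measure) \<Rightarrow>
   ('x \<Rightarrow> 'a \<Rightarrow> ('a \<Rightarrow>\<^sub>L real)) \<Rightarrow> ('a \<Rightarrow> ('a \<Rightarrow>\<^sub>L real)) \<Rightarrow> bool" where
  "variable_lipschitz_oracle L A \<Xi> Q Fo F \<longleftrightarrow>
     (\<forall>u\<in>A. \<forall>v\<in>A.
        Q u v \<in> space (prob_algebra \<Xi>) \<and>
        (\<forall>z\<in>A. has_dual_expectation (Q u v) (\<lambda>\<xi>. Fo \<xi> z) (F z)) \<and>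
        integrable (Q u v) (\<lambda>\<xi>. (norm (Fo \<xi> u - Fo \<xi> v))\<^sup>2) \<and>
        (\<integral>\<xi>. (norm (Fo \<xi> u - Fo \<xi> v))\<^sup>2 \<partial>Q u v) \<le> L\<^sup>2 * (norm (u - v))\<^sup>2)"


subsection \<open>Mirror-Prox with variance reduction\<close>

definition prox_objective ::
  "('a::real_normed_vector \<Rightarrow> ereal) \<Rightarrow> ('a \<Rightarrow> ereal) \<Rightarrow> real \<Rightarrow> real \<Rightarrow>
   ('a \<Rightarrow>\<^sub>L real) \<Rightarrow> 'a \<Rightarrow> 'a \<Rightarrow> 'a \<Rightarrow> ereal" where
  "prox_objective g h \<alpha> \<tau> p y wbar z =
     g z + ereal (blinfun_apply p z) + ereal (\<alpha> / \<tau>) * bregman h z y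
       + ereal ((1 - \<alpha>) / \<tau>) * bregman h z wbar"

text \<open>One run of the method along a fixed sequence of samples \<open>\<xi> s k\<close>. Here \<open>z s k\<close> stands for
  $z_k^s$ with \<open>0 \<le> k \<le> K\<close>, and \<open>zh s k\<close> for $z_{k+1/2}^s$ with \<open>k < K\<close>. The run is well defined:
  the points used as second argument of the Bregman distance lie in \<open>dom_subdiff h\<close>.\<close>

definition mirror_prox_vr_run ::
  "('a::real_normed_vector \<Rightarrow> ereal) \<Rightarrow> ('a \<Rightarrow> ereal) \<Rightarrow> ('a \<Rightarrow> ('a \<Rightarrow>\<^sub>L real)) \<Rightarrow>
   ('x \<Rightarrow> 'a \<Rightarrow> ('a \<Rightarrow>\<^sub>L real)) \<Rightarrow> real \<Rightarrow> real \<Rightarrow> nat \<Rightarrow> 'a \<Rightarrow> (nat \<Rightarrow> nat \<Rightarrow> 'x) \<Rightarrow>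
   (nat \<Rightarrow> nat \<Rightarrow> 'a) \<Rightarrow> (nat \<Rightarrow> nat \<Rightarrow> 'a) \<Rightarrow> (nat \<Rightarrow> 'a) \<Rightarrow> (nat \<Rightarrow> 'a) \<Rightarrow> bool" where
  "mirror_prox_vr_run g h F Fo \<alpha> \<tau> K z0 \<xi> z zh w wbar \<longleftrightarrow>
     z 0 0 = z0 \<and> w 0 = z0 \<and> wbar 0 = z0 \<and>
     (\<forall>s. \<forall>k\<le>K. z s k \<in> dom_subdiff h) \<and>
     (\<forall>s. wbar s \<in> dom_subdiff h) \<and>
     (\<forall>s. \<forall>k<K.
        is_arg_min (prox_objective g h \<alpha> \<tau> (F (w s)) (z s k) (wbar s)) (\<lambda>_. True) (zh s k) \<and>
        is_arg_min
          (prox_objective g h \<alpha> \<tau>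
             (F (w s) + Fo (\<xi> s k) (zh s k) - Fo (\<xi> s k) (w s)) (z s k) (wbar s))
          (\<lambda>_. True) (z s (Suc k))) \<and>
     (\<forall>s. w (Suc s) = (1 / real K) *\<^sub>R (\<Sum>k=1..K. z s k) \<and>
          gradient h (wbar (Suc s)) = (1 / real K) *\<^sub>R (\<Sum>k=1..K. gradient h (z s k)) \<and>
          z (Suc s) 0 = z s K)"

text \<open>The random process generated by the method on a probability space \<open>M\<close>: every sample path is
  a run, and \<open>\<xi> s k\<close> is drawn from \<open>Q (zh s k) (w s)\<close> given the past. \<open>G n\<close> is the information
  available before the sample number \<open>n = s * K + k\<close> is drawn. The measurability conditions are
  those needed for the expectations of the method to be meaningful; in the last three the pair
  ranges over the past and a fresh sample.\<close>

definition mirror_prox_vr_process ::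
  "'w measure \<Rightarrow> (nat \<Rightarrow> 'w measure) \<Rightarrow> 'x measure \<Rightarrow> ('a \<Rightarrow> 'a \<Rightarrow> 'x measure) \<Rightarrow>
   ('a::real_normed_vector \<Rightarrow> ereal) \<Rightarrow> ('a \<Rightarrow> ereal) \<Rightarrow> ('a \<Rightarrow> ('a \<Rightarrow>\<^sub>L real)) \<Rightarrow>
   ('x \<Rightarrow> 'a \<Rightarrow> ('a \<Rightarrow>\<^sub>L real)) \<Rightarrow> real \<Rightarrow> real \<Rightarrow> nat \<Rightarrow> 'a \<Rightarrow> (nat \<Rightarrow> nat \<Rightarrow> 'w \<Rightarrow> 'x) \<Rightarrow>
   (nat \<Rightarrow> nat \<Rightarrow> 'w \<Rightarrow> 'a) \<Rightarrow> (nat \<Rightarrow> nat \<Rightarrow> 'w \<Rightarrow> 'a) \<Rightarrow> (nat \<Rightarrow> 'w \<Rightarrow> 'a) \<Rightarrow> (nat \<Rightarrow> 'w \<Rightarrow> 'a) \<Rightarrow>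
   bool" where
  "mirror_prox_vr_process M G \<Xi> Q g h F Fo \<alpha> \<tau> K z0 \<xi> z zh w wbar \<longleftrightarrow>
     prob_space M \<and> filtration (space M) G \<and> (\<forall>n. subalgebra M (G n)) \<and>
     (\<forall>\<omega>\<in>space M.
        mirror_prox_vr_run g h F Fo \<alpha> \<tau> K z0 (\<lambda>s k. \<xi> s k \<omega>) (\<lambda>s k. z s k \<omega>)
          (\<lambda>s k. zh s k \<omega>) (\<lambda>s. w s \<omega>) (\<lambda>s. wbar s \<omega>)) \<and>
     (\<forall>s. \<forall>k\<le>K. strongly_measurable (G (s * K + k)) (z s k)) \<and>
     (\<forall>s. \<forall>k<K.
        strongly_measurable (G (s * K + k)) (zh s k) \<and>
        \<xi> s k \<in> G (Suc (s * K + k)) \<rightarrow>\<^sub>M \<Xi> \<and>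
        sampled_from M (G (s * K + k)) \<Xi> (\<xi> s k) (\<lambda>\<omega>. Q (zh s k \<omega>) (w s \<omega>)) \<and>
        (\<forall>d. (\<lambda>(\<omega>, x). blinfun_apply (Fo x (zh s k \<omega>)) d)
               \<in> borel_measurable (G (s * K + k) \<Otimes>\<^sub>M \<Xi>)) \<and>
        (\<forall>d. (\<lambda>(\<omega>, x). blinfun_apply (Fo x (w s \<omega>)) d)
               \<in> borel_measurable (G (s * K + k) \<Otimes>\<^sub>M \<Xi>)) \<and>
        (\<lambda>(\<omega>, x). norm (Fo x (zh s k \<omega>) - Fo x (w s \<omega>)))
          \<in> borel_measurable (G (s * K + k) \<Otimes>\<^sub>M \<Xi>))"

end

theory Submission
  imports Defs
begin

text \<open>Write \<open>\<Delta>\<close> for \<open>F\<^sub>\<xi>(z\<^bsub>k+1/2\<^esub>) - F\<^sub>\<xi>(w)\<close> and \<open>v\<close> for the error of the estimator, that is, the mean of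
  \<open>\<Delta>\<close> minus \<open>\<Delta>\<close>. In an inner step the half step is tested at the result of the full step, and the
  full step at an arbitrary point \<open>u\<close>; the growth of the strongly convex objective pays for the
  change of the operator estimate between the two (\<open>extragradient_step\<close>). The gradient of \<open>h\<close>
  at \<open>wbar\<close> is the mean of its gradients at the iterates of the previous epoch, so the distances
  to \<open>wbar\<close> and the mean distances to these iterates differ by a constant in the first argument.
  This turns the anchoring term into a telescoping potential and leaves over the negative
  amount \<open>- (1 - \<alpha>)/2 |z\<^bsub>k+1/2\<^esub> - w|\<^sup>2\<close> (\<open>inner_step_bound\<close>). Summation, monotonicity of \<open>F\<close> and convexity
  of \<open>g\<close> bound \<open>\<tau> K S\<close> times the gap expression at \<open>u\<close> by
  \<open>(\<alpha> + K (1 - \<alpha>)) D u z0 + \<Sum> (\<tau> \<langle>v, z\<^bsub>k+1/2\<^esub> - u\<rangle> + \<tau>\<^sup>2/2 |\<Delta>|\<^sup>2 - (1 - \<alpha>)/2 |z\<^bsub>k+1/2\<^esub> - w|\<^sup>2)\<close>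
  for every sample path (\<open>gap_bound\<close>).

  Given the past, \<open>|\<Delta>|\<^sup>2\<close> has mean at most \<open>L\<^sup>2 |z\<^bsub>k+1/2\<^esub> - w|\<^sup>2\<close>, and \<open>v\<close> pairs to mean zero with every point
  known before the sample is drawn. The point \<open>u\<close> that maximises the gap is not such a point. The
  sum of \<open>- \<tau> \<langle>v, u - z0\<rangle>\<close> is therefore split by Fenchel's inequality into \<open>c D u z0\<close> and the convex
  conjugate of \<open>c D _ z0\<close> at the accumulated noise. Strong convexity makes this
  conjugate smooth: each new \<open>v\<close> adds its pairing with the current maximiser, which has mean zero,
  and a multiple of \<open>|v|\<^sup>2\<close> (\<open>dual_averaging_regret\<close>). In a general normed space the maximisers need
  not exist, let alone depend measurably on the noise; approximate maximisers in a countable set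
  that is closed under midpoints and contains a dense subset of \<open>C \<inter> eff_dom g\<close> do the same work
  (\<open>noise_support_bound\<close>).

  With \<open>c = 8 \<gamma>\<^sup>2/(1 - \<gamma>\<^sup>2)\<close> and \<open>\<tau>\<^sup>2 L\<^sup>2 = (1 - \<alpha>) \<gamma>\<^sup>2\<close> the second moments of \<open>v\<close> and \<open>\<Delta>\<close> cancel exactly
  against the negative term, and the constant \<open>\<alpha> + K (1 - \<alpha>) + c\<close> remains (\<open>gap_majorant\<close>). It is at
  most the asserted one because \<open>\<alpha> + K (1 - \<alpha>) \<ge> 1\<close>. The cancellation requires that these moments are
  finite; this follows by induction along the run from bounds in terms of the distances to a solution of
  the variational inequality (\<open>square_integrability\<close>).\<close>

section \<open>Bregman geometry and prox steps\<close>

text \<open>Compares a one-sided difference quotient with its limit. Every first-order statement below, from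
  the gradient inequality to the optimality of prox points, is an instance: the bound holds along
  a segment, and the quadratic gain \<open>b\<close> survives in the limit.\<close>

lemma slope_le:
  fixes f :: "real \<Rightarrow> real"
  assumes f: "(f has_real_derivative l) (at 0)"
    and le: "\<And>t. 0 < t \<Longrightarrow> t \<le> 1 \<Longrightarrow> f t \<le> f 0 + t * a - t * (1 - t) * b"
  shows "l \<le> a - b"
proof (rule tendsto_le)
  show "((\<lambda>t. (f t - f 0) / t) \<longlongrightarrow> l) (at_right 0)"
    using f by (auto simp: has_field_derivative_iff intro: filterlim_at_split[THEN iffD1, THEN conjunct2])
  show "((\<lambda>t. a - (1 - t) * b) \<longlongrightarrow> a - b) (at_right 0)"
    by (auto intro!: tendsto_eq_intros)
  have "(f t - f 0) / t \<le> a - (1 - t) * b" if "0 < t" "t \<le> 1" for t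
  proof -
    have "f t - f 0 \<le> t * (a - (1 - t) * b)"
      using le[OF that] by (simp add: algebra_simps)
    then show ?thesis
      using that by (simp add: divide_le_eq mult.commute)
  qed
  then show "\<forall>\<^sub>F t in at_right 0. (f t - f 0) / t \<le> a - (1 - t) * b"
    by (auto simp: eventually_at_right[of "0::real" 1, simplified] intro!: exI[of _ 1])
qed simp

lemma eff_dom_convex:
  assumes "convex_fun f" "proper_fun f"
  shows "convex (eff_dom f)"
proof (rule convexI)
  fix x y and u v :: real
  assume *: "x \<in> eff_dom f" "y \<in> eff_dom f" "0 \<le> u" "0 \<le> v" "u + v = 1"
  then have u: "u = 1 - v" and v: "v \<in> {0..1}" by auto
  have "f ((1 - v) *\<^sub>R x + v *\<^sub>R y) \<le> ereal (1 - v) * f x + ereal v * f y"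
    using assms(1) v unfolding convex_fun_def by blast
  also have "\<dots> < \<infinity>"
    using * assms(2) unfolding eff_dom_def proper_fun_def
    by (cases "f x"; cases "f y") auto
  finally show "u *\<^sub>R x + v *\<^sub>R y \<in> eff_dom f"
    by (simp add: u eff_dom_def)
qed

lemma real_part:
  assumes "proper_fun f" "x \<in> eff_dom f"
  shows "f x = ereal (real_of_ereal (f x))"
  using assms unfolding proper_fun_def eff_dom_def by (cases "f x") auto

lemma gradient_has_gradient:
  assumes "has_gradient h p v"
  shows "has_gradient h (gradient h v) v"
  unfolding gradient_def
proof (rule theI[of _ p])
  show "q = p" if "has_gradient h q v" for q
    using that assms unfolding has_gradient_def
    by (metis DERIV_unique blinfun_eqI)
qed (fact assms)

lemma norm_mean_square_le:
  fixes a :: "nat \<Rightarrow> 'b::real_normed_vector"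
  assumes "K > 0"
  shows "(norm ((1 / real K) *\<^sub>R (\<Sum>j<K. a j)))\<^sup>2 \<le> (1 / real K) * (\<Sum>j<K. (norm (a j))\<^sup>2)"
proof -
  have "(norm (\<Sum>j<K. a j))\<^sup>2 \<le> (\<Sum>j<K. norm (a j))\<^sup>2"
    by (intro power_mono norm_sum) auto
  also have "\<dots> \<le> (\<Sum>j<K. (norm (a j))\<^sup>2) * real K"
    using sum_squared_le_sum_of_squares[of "\<lambda>j. norm (a j)" "{..<K}"] by simp
  finally show ?thesis
    using assms by (simp add: power_mult_distrib power_divide field_simps power2_eq_square)
qed

locale prox_geometry =
  fixes g h :: "'a::real_normed_vector \<Rightarrow> ereal"
  assumes proper_g: "proper_fun g" and convex_g: "convex_fun g"
    and proper_h: "proper_fun h" and convex_h: "convex_fun h"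
    and dom_gh: "eff_dom g \<subseteq> eff_dom h"
    and h_diff: "\<And>v. v \<in> dom_subdiff h \<Longrightarrow> \<exists>p. has_gradient h p v"
    and h_sc: "strongly_convex_on 1 (eff_dom g) h"
begin

text \<open>The convexity arguments are carried out with real functions. On the effective domains they agree
  with \<open>g\<close>, \<open>h\<close> and \<^const>\<open>bregman\<close> (\<open>g_real\<close>, \<open>h_real\<close>, \<open>bregman_eq\<close>); elsewhere their values are
  meaningless.\<close>

definition "gR x = real_of_ereal (g x)"
definition "hR x = real_of_ereal (h x)"
definition "D u v = hR u - hR v - blinfun_apply (gradient h v) (u - v)"

lemma g_real: "x \<in> eff_dom g \<Longrightarrow> g x = ereal (gR x)"
  using real_part[OF proper_g] by (simp add: gR_def)

lemma h_real: "x \<in> eff_dom h \<Longrightarrow> h x = ereal (hR x)"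
  using real_part[OF proper_h] by (simp add: hR_def)

lemma dom_subdiff_dom: "v \<in> dom_subdiff h \<Longrightarrow> v \<in> eff_dom h"
  by (auto simp: dom_subdiff_def subdifferential_def)

lemma bregman_eq: "u \<in> eff_dom h \<Longrightarrow> v \<in> dom_subdiff h \<Longrightarrow> bregman h u v = ereal (D u v)"
  by (simp add: bregman_def D_def h_real dom_subdiff_dom)

lemmas convex_dom_g = eff_dom_convex[OF convex_g proper_g]

lemma segment_dom_g:
  assumes "x \<in> eff_dom g" "y \<in> eff_dom g" "0 \<le> t" "t \<le> 1"
  shows "(1 - t) *\<^sub>R x + t *\<^sub>R y \<in> eff_dom g"
  using convexD[OF convex_dom_g assms(1,2), of "1 - t" t] assms by simp

lemma segment_dom_h:
  assumes "x \<in> eff_dom h" "y \<in> eff_dom h" "0 \<le> t" "t \<le> 1"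
  shows "(1 - t) *\<^sub>R x + t *\<^sub>R y \<in> eff_dom h"
  using convexD[OF eff_dom_convex[OF convex_h proper_h] assms(1,2), of "1 - t" t] assms by simp

lemma gR_convex:
  assumes "x \<in> eff_dom g" "y \<in> eff_dom g" "0 \<le> t" "t \<le> 1"
  shows "gR ((1 - t) *\<^sub>R x + t *\<^sub>R y) \<le> (1 - t) * gR x + t * gR y"
proof -
  have "g ((1 - t) *\<^sub>R x + t *\<^sub>R y) \<le> ereal (1 - t) * g x + ereal t * g y"
    using convex_g assms unfolding convex_fun_def by simp
  then show ?thesis
    using assms by (simp add: g_real segment_dom_g)
qed

lemma gR_convex_on: "convex_on (eff_dom g) gR"
  using gR_convex by (intro convex_onI convex_dom_g) auto

lemma hR_convex:
  assumes "x \<in> eff_dom h" "y \<in> eff_dom h" "0 \<le> t" "t \<le> 1"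
  shows "hR ((1 - t) *\<^sub>R x + t *\<^sub>R y) \<le> (1 - t) * hR x + t * hR y"
proof -
  have "h ((1 - t) *\<^sub>R x + t *\<^sub>R y) \<le> ereal (1 - t) * h x + ereal t * h y"
    using convex_h assms unfolding convex_fun_def by simp
  then show ?thesis
    using assms by (simp add: h_real segment_dom_h)
qed

lemma hR_strongly_convex:
  assumes "x \<in> eff_dom g" "y \<in> eff_dom g" "0 \<le> t" "t \<le> 1"
  shows "hR ((1 - t) *\<^sub>R x + t *\<^sub>R y) \<le> (1 - t) * hR x + t * hR y - t * (1 - t) * ((norm (x - y))\<^sup>2 / 2)"
proof -
  have "h ((1 - t) *\<^sub>R x + t *\<^sub>R y) + ereal (1 / 2 * t * (1 - t) * (norm (x - y))\<^sup>2)
      \<le> ereal (1 - t) * h x + ereal t * h y"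
    using h_sc assms unfolding strongly_convex_on_def by simp
  then show ?thesis
    using assms dom_gh segment_dom_g[OF assms] by (simp add: h_real subset_iff)
qed

lemma hR_deriv:
  assumes "v \<in> dom_subdiff h"
  shows "((\<lambda>t. hR (v + t *\<^sub>R d)) has_real_derivative blinfun_apply (gradient h v) d) (at 0)"
  using h_diff[OF assms] gradient_has_gradient unfolding has_gradient_def hR_def by blast

lemma segment_shift: "v + t *\<^sub>R (u - v) = (1 - t) *\<^sub>R v + t *\<^sub>R (u::'a)"
  by (simp add: algebra_simps)

lemma D_nonneg:
  assumes "u \<in> eff_dom h" "v \<in> dom_subdiff h"
  shows "0 \<le> D u v"
proof -
  have "blinfun_apply (gradient h v) (u - v) \<le> (hR u - hR v) - 0"
  proof (rule slope_le[OF hR_deriv[OF assms(2)]])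
    fix t :: real assume "0 < t" "t \<le> 1"
    then show "hR (v + t *\<^sub>R (u - v)) \<le> hR (v + 0 *\<^sub>R (u - v)) + t * (hR u - hR v) - t * (1 - t) * 0"
      using hR_convex[OF dom_subdiff_dom[OF assms(2)] assms(1), of t]
      by (simp add: segment_shift algebra_simps)
  qed
  then show ?thesis by (simp add: D_def)
qed

lemma D_ge_square:
  assumes "u \<in> eff_dom g" "v \<in> eff_dom g" "v \<in> dom_subdiff h"
  shows "(norm (u - v))\<^sup>2 / 2 \<le> D u v"
proof -
  have "blinfun_apply (gradient h v) (u - v) \<le> (hR u - hR v) - (norm (v - u))\<^sup>2 / 2"
  proof (rule slope_le[OF hR_deriv[OF assms(3)]])
    fix t :: real assume "0 < t" "t \<le> 1"
    then show "hR (v + t *\<^sub>R (u - v)) \<le> hR (v + 0 *\<^sub>R (u - v)) + t * (hR u - hR v)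
       - t * (1 - t) * ((norm (v - u))\<^sup>2 / 2)"
      using hR_strongly_convex[OF assms(2,1), of t]
      by (simp add: segment_shift algebra_simps)
  qed
  then show ?thesis by (simp add: D_def norm_minus_commute)
qed

text \<open>The prox objective multiplied by \<open>\<tau>\<close>. The weights \<open>\<alpha>\<close> and \<open>1 - \<alpha>\<close> add up to one, so it is \<open>h\<close> plus a
  convex function and hence 1-strongly convex on the domain of \<open>g\<close>.\<close>

definition "prox_obj \<alpha> \<tau> p y b u = \<tau> * (gR u + blinfun_apply p u) + \<alpha> * D u y + (1 - \<alpha>) * D u b"

lemma prox_minimizer:
  assumes "is_arg_min (prox_objective g h \<alpha> \<tau> p y b) (\<lambda>_. True) x"
    and \<tau>: "\<tau> > 0" and \<alpha>: "0 \<le> \<alpha>" "\<alpha> \<le> 1"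
    and y: "y \<in> dom_subdiff h" and b: "b \<in> dom_subdiff h"
  shows "x \<in> eff_dom g"
    and "u \<in> eff_dom g \<Longrightarrow> prox_obj \<alpha> \<tau> p y b x \<le> prox_obj \<alpha> \<tau> p y b u"
proof -
  let ?P = "prox_objective g h \<alpha> \<tau> p y b"
  have min: "?P x \<le> ?P u" for u
    using assms(1) by (auto simp: is_arg_min_def not_less)
  have fin: "?P u = ereal (prox_obj \<alpha> \<tau> p y b u / \<tau>)" if "u \<in> eff_dom g" for u
    using that \<tau> y b dom_gh
    by (auto simp: prox_objective_def prox_obj_def g_real bregman_eq subset_iff field_simps)
  obtain u0 where u0: "u0 \<in> eff_dom g"
    using proper_g by (auto simp: proper_fun_def)
  have ninf: "bregman h x v \<noteq> -\<infinity>" if "v \<in> dom_subdiff h" for v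
    using proper_h dom_subdiff_dom[OF that] unfolding bregman_def
    by (cases "h x") (auto simp: h_real proper_fun_def)
  have scaled: "ereal c * bregman h x v \<noteq> -\<infinity>" if "v \<in> dom_subdiff h" "0 \<le> c" for c v
    using ninf[OF that(1)] that(2) by (cases "bregman h x v") auto
  show x: "x \<in> eff_dom g"
  proof (rule ccontr)
    assume "x \<notin> eff_dom g"
    then have "g x = \<infinity>" by (simp add: eff_dom_def)
    then have "?P x = \<infinity>"
      using scaled[OF y, of "\<alpha> / \<tau>"] scaled[OF b, of "(1 - \<alpha>) / \<tau>"] \<tau> \<alpha>
      unfolding prox_objective_def by simp
    then show False using min[of u0] fin[OF u0] by simp
  qed
  show "prox_obj \<alpha> \<tau> p y b x \<le> prox_obj \<alpha> \<tau> p y b u" if "u \<in> eff_dom g"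
    using min[of u] \<tau> by (simp add: fin[OF x] fin[OF that] divide_le_cancel)
qed

lemma prox_obj_affine:
  "prox_obj \<alpha> \<tau> p y b u - prox_obj \<alpha> \<tau> p y b x = \<tau> * (gR u - gR x + blinfun_apply p (u - x)) + (hR u - hR x)
    - \<alpha> * blinfun_apply (gradient h y) (u - x) - (1 - \<alpha>) * blinfun_apply (gradient h b) (u - x)"
  by (simp add: prox_obj_def D_def blinfun.diff_right algebra_simps)

text \<open>A minimiser of a 1-strongly convex function is beaten by half the squared distance. Unlike
  \<open>prox_three_point\<close> this does not involve a gradient of \<open>h\<close> at the minimiser, which for the half
  steps of the method need not exist.\<close>

lemma prox_quadratic_growth:
  assumes min: "is_arg_min (prox_objective g h \<alpha> \<tau> p y b) (\<lambda>_. True) x"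
    and par: "\<tau> > 0" "0 \<le> \<alpha>" "\<alpha> \<le> 1"
    and yb: "y \<in> dom_subdiff h" "b \<in> dom_subdiff h"
    and u: "u \<in> eff_dom g"
  shows "(norm (u - x))\<^sup>2 / 2 + \<alpha> * (D x y - D u y) + (1 - \<alpha>) * (D x b - D u b)
    \<le> \<tau> * (blinfun_apply p (u - x) + gR u - gR x)"
proof -
  note min = prox_minimizer[OF min par yb]
  let ?P = "prox_obj \<alpha> \<tau> p y b"
  have "0 \<le> (?P u - ?P x) - (norm (x - u))\<^sup>2 / 2"
  proof (rule slope_le[where f = "\<lambda>_. ?P x"])
    fix t :: real assume t: "0 < t" "t \<le> 1"
    define v where "v = x + t *\<^sub>R (u - x)"
    have vx: "v - x = t *\<^sub>R (u - x)" and vc: "v = (1 - t) *\<^sub>R x + t *\<^sub>R u"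
      by (simp_all add: v_def scaleR_diff_left scaleR_diff_right)
    have v: "v \<in> eff_dom g"
      using segment_dom_g[OF min(1) u, of t] t by (simp add: vc)
    have "0 \<le> ?P v - ?P x" using min(2)[OF v] by simp
    also have "\<dots> \<le> t * (?P u - ?P x) - t * (1 - t) * ((norm (x - u))\<^sup>2 / 2)"
    proof -
      have "\<tau> * gR v \<le> \<tau> * ((1 - t) * gR x + t * gR u)"
        using gR_convex[OF min(1) u, of t] t par by (simp add: vc)
      moreover have "hR v \<le> (1 - t) * hR x + t * hR u - t * (1 - t) * ((norm (x - u))\<^sup>2 / 2)"
        using hR_strongly_convex[OF min(1) u, of t] t by (simp add: vc)
      ultimately show ?thesis
        unfolding prox_obj_affine vx blinfun.scaleR_right by (simp add: algebra_simps)
    qed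
    finally show "?P x \<le> ?P x + t * (?P u - ?P x) - t * (1 - t) * ((norm (x - u))\<^sup>2 / 2)"
      by simp
  qed simp
  then show ?thesis
    by (simp add: prox_obj_def blinfun.diff_right norm_minus_commute algebra_simps)
qed

text \<open>First-order optimality of the minimiser in the direction of \<open>u\<close>, with the gradients of \<open>h\<close> rewritten
  as Bregman distances by the three-point identity.\<close>

lemma prox_three_point:
  assumes min: "is_arg_min (prox_objective g h \<alpha> \<tau> p y b) (\<lambda>_. True) x"
    and par: "\<tau> > 0" "0 \<le> \<alpha>" "\<alpha> \<le> 1"
    and yb: "y \<in> dom_subdiff h" "b \<in> dom_subdiff h"
    and x: "x \<in> dom_subdiff h" and u: "u \<in> eff_dom g"
  shows "D u x + \<alpha> * (D x y - D u y) + (1 - \<alpha>) * (D x b - D u b)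
    \<le> \<tau> * (blinfun_apply p (u - x) + gR u - gR x)"
proof -
  note min = prox_minimizer[OF min par yb]
  define q where "q = \<alpha> * blinfun_apply (gradient h y) (u - x) + (1 - \<alpha>) * blinfun_apply (gradient h b) (u - x)"
  have "- blinfun_apply (gradient h x) (u - x) \<le> (\<tau> * (gR u - gR x + blinfun_apply p (u - x)) - q) - 0"
  proof (rule slope_le[OF DERIV_minus[OF hR_deriv[OF x]]])
    fix t :: real assume t: "0 < t" "t \<le> 1"
    define v where "v = x + t *\<^sub>R (u - x)"
    have vx: "v - x = t *\<^sub>R (u - x)" and vc: "v = (1 - t) *\<^sub>R x + t *\<^sub>R u"
      by (simp_all add: v_def scaleR_diff_left scaleR_diff_right)
    have v: "v \<in> eff_dom g"
      using segment_dom_g[OF min(1) u, of t] t by (simp add: vc)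
    have "0 \<le> prox_obj \<alpha> \<tau> p y b v - prox_obj \<alpha> \<tau> p y b x" using min(2)[OF v] by simp
    also have "\<dots> \<le> \<tau> * (t * (gR u - gR x) + t * blinfun_apply p (u - x)) + (hR v - hR x) - t * q"
    proof -
      have "\<tau> * gR v \<le> \<tau> * ((1 - t) * gR x + t * gR u)"
        using gR_convex[OF min(1) u, of t] t par by (simp add: vc)
      then show ?thesis
        unfolding prox_obj_affine q_def vx blinfun.scaleR_right by (simp add: algebra_simps)
    qed
    finally show "- hR v \<le> - hR (x + 0 *\<^sub>R (u - x)) +
        t * (\<tau> * (gR u - gR x + blinfun_apply p (u - x)) - q) - t * (1 - t) * 0"
      by (simp add: v_def algebra_simps)
  qed
  then show ?thesis
    by (simp add: q_def D_def blinfun.diff_right algebra_simps)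
qed

text \<open>Adds \<open>prox_three_point\<close> for the full step \<open>x\<close>, tested at \<open>u\<close>, to \<open>prox_quadratic_growth\<close> for the
  half step \<open>zh\<close>, tested at \<open>x\<close>. The distances from \<open>x\<close> to the two centres cancel, and the
  quadratic term absorbs \<open>\<tau> \<langle>q - p, zh - x\<rangle>\<close> up to \<open>\<tau>\<^sup>2/2 |q - p|\<^sup>2\<close>.\<close>

lemma extragradient_step:
  assumes zh: "is_arg_min (prox_objective g h \<alpha> \<tau> p y b) (\<lambda>_. True) zh"
    and x: "is_arg_min (prox_objective g h \<alpha> \<tau> q y b) (\<lambda>_. True) x"
    and par: "\<tau> > 0" "0 \<le> \<alpha>" "\<alpha> \<le> 1"
    and yb: "y \<in> dom_subdiff h" "b \<in> dom_subdiff h"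
    and xd: "x \<in> dom_subdiff h" and u: "u \<in> eff_dom g"
  shows "\<tau> * (blinfun_apply q (zh - u) + gR zh - gR u) + D u x
    \<le> \<alpha> * D u y + (1 - \<alpha>) * (D u b - D zh b) + \<tau>\<^sup>2 / 2 * (norm (q - p))\<^sup>2"
proof -
  have xg: "x \<in> eff_dom g" and zg: "zh \<in> eff_dom g"
    using prox_minimizer(1)[OF x par yb] prox_minimizer(1)[OF zh par yb] .
  have 1: "D u x + \<alpha> * (D x y - D u y) + (1 - \<alpha>) * (D x b - D u b)
    \<le> \<tau> * (blinfun_apply q (u - x) + gR u - gR x)"
    by (rule prox_three_point[OF x par yb xd u])
  have 2: "(norm (x - zh))\<^sup>2 / 2 + \<alpha> * (D zh y - D x y) + (1 - \<alpha>) * (D zh b - D x b)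
    \<le> \<tau> * (blinfun_apply p (x - zh) + gR x - gR zh)"
    by (rule prox_quadratic_growth[OF zh par yb xg])
  \<comment> \<open>Young's inequality, with the weight that matches the quadratic term of \<open>2\<close>.\<close>
  have 3: "\<tau> * blinfun_apply (q - p) (zh - x) \<le> \<tau>\<^sup>2 / 2 * (norm (q - p))\<^sup>2 + (norm (x - zh))\<^sup>2 / 2"
  proof -
    have "\<tau> * blinfun_apply (q - p) (zh - x) \<le> \<tau> * (norm (q - p) * norm (zh - x))"
      using norm_blinfun[of "q - p" "zh - x"] par by (intro mult_left_mono) auto
    also have "\<dots> \<le> \<tau>\<^sup>2 / 2 * (norm (q - p))\<^sup>2 + (norm (x - zh))\<^sup>2 / 2"
      using sum_squares_bound[of "\<tau> * norm (q - p)" "norm (zh - x)"]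
      by (simp add: power_mult_distrib norm_minus_commute)
    finally show ?thesis .
  qed
  have 4: "0 \<le> \<alpha> * D zh y"
    using par D_nonneg[of zh y] zg dom_gh yb by auto
  have "\<tau> * (blinfun_apply q (u - x) + gR u - gR x) + \<tau> * (blinfun_apply p (x - zh) + gR x - gR zh)
    = \<tau> * blinfun_apply (q - p) (zh - x) - \<tau> * (blinfun_apply q (zh - u) + gR zh - gR u)"
    by (simp add: blinfun.diff_left blinfun.diff_right algebra_simps)
  then show ?thesis
    using 1 2 3 4 by (simp add: algebra_simps)
qed

text \<open>The difference \<open>D u b - D v b\<close> is affine in the gradient at \<open>b\<close>, so averaging the gradients
  averages the differences.\<close>

lemma mean_gradient:
  assumes b: "gradient h b = (1 / real K) *\<^sub>R (\<Sum>j<K. gradient h (y j))" and K: "K > 0"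
  shows "D u b - D v b = (1 / real K) * (\<Sum>j<K. D u (y j) - D v (y j))"
proof -
  have "(\<Sum>j<K. D u (y j) - D v (y j)) = (\<Sum>j<K. (hR u - hR v) - blinfun_apply (gradient h (y j)) (u - v))"
    by (rule sum.cong) (auto simp: D_def blinfun.diff_right)
  also have "\<dots> = real K * (hR u - hR v) - (\<Sum>j<K. blinfun_apply (gradient h (y j)) (u - v))"
    by (simp add: sum_subtractf)
  also have "(\<Sum>j<K. blinfun_apply (gradient h (y j)) (u - v)) = real K * blinfun_apply (gradient h b) (u - v)"
    using K by (simp add: b blinfun.scaleR_left blinfun.sum_left)
  finally show ?thesis
    using K by (simp add: D_def blinfun.diff_right field_simps)
qed

text \<open>Apply \<open>mean_gradient\<close> with \<open>v = b\<close>: there \<open>D b b = 0\<close>, and the distances from \<open>b\<close> are nonnegative.\<close>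

lemma mean_anchor_le:
  assumes b: "gradient h b = (1 / real K) *\<^sub>R (\<Sum>j<K. gradient h (y j))" and K: "K > 0"
    and bd: "b \<in> dom_subdiff h" and y: "\<And>j. j < K \<Longrightarrow> y j \<in> dom_subdiff h"
  shows "D u b \<le> (1 / real K) * (\<Sum>j<K. D u (y j))"
proof -
  have "0 \<le> (\<Sum>j<K. D b (y j))"
    using D_nonneg[OF dom_subdiff_dom[OF bd]] y by (intro sum_nonneg) auto
  moreover have "D b b = 0" by (simp add: D_def)
  ultimately show ?thesis
    using mean_gradient[OF b K, of u b] K by (simp add: sum_subtractf field_simps)
qed

text \<open>Jensen's inequality for the squared norm, followed by \<open>D_ge_square\<close>.\<close>

lemma mean_square_le_mean_D:
  assumes K: "K > 0" and y: "\<And>j. j < K \<Longrightarrow> y j \<in> dom_subdiff h \<inter> eff_dom g" and v: "v \<in> eff_dom g"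
  shows "(norm (v - (1 / real K) *\<^sub>R (\<Sum>j<K. y j)))\<^sup>2 / 2 \<le> (1 / real K) * (\<Sum>j<K. D v (y j))"
proof -
  have eq: "v - (1 / real K) *\<^sub>R (\<Sum>j<K. y j) = (1 / real K) *\<^sub>R (\<Sum>j<K. v - y j)"
    using K by (simp add: sum_subtractf scaleR_diff_right sum_constant_scaleR)
  have "(norm (v - (1 / real K) *\<^sub>R (\<Sum>j<K. y j)))\<^sup>2 / 2 \<le> (1 / real K) * (\<Sum>j<K. (norm (v - y j))\<^sup>2 / 2)"
    unfolding eq using norm_mean_square_le[OF K, of "\<lambda>j. v - y j"] by (simp add: sum_divide_distrib[symmetric])
  also have "\<dots> \<le> (1 / real K) * (\<Sum>j<K. D v (y j))"
    using D_ge_square[OF v] y by (intro mult_left_mono sum_mono) auto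
  finally show ?thesis .
qed

end

section \<open>Strongly measurable maps and fresh samples\<close>

text \<open>Let \<open>e\<close> enumerate a countable set whose closure contains the range, and take the first element of
  this enumeration that is \<open>1/(n + 1)\<close>-close.\<close>

lemma strongly_measurable_approx:
  assumes "strongly_measurable M f"
  shows "\<exists>(i :: nat \<Rightarrow> 'w \<Rightarrow> nat) (e :: nat \<Rightarrow> 'a::real_normed_vector).
    (\<forall>n. i n \<in> M \<rightarrow>\<^sub>M count_space UNIV) \<and> (\<forall>\<omega>\<in>space M. (\<lambda>n. e (i n \<omega>)) \<longlonglongrightarrow> f \<omega>)"
proof -
  obtain D where f: "f \<in> borel_measurable M" and D: "countable D" "f ` space M \<subseteq> closure D"
    using assms unfolding strongly_measurable_def by blast
  define e where "e = from_nat_into D"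
  define i where "i n \<omega> = (LEAST m. dist (e m) (f \<omega>) < 1 / real (Suc n))" for n \<omega>
  have "(\<lambda>\<omega>. dist (e m) (f \<omega>)) \<in> borel_measurable M" for m
    by (rule measurable_compose[OF f]) (intro borel_measurable_continuous_onI continuous_intros)
  then have "Measurable.pred M (\<lambda>\<omega>. dist (e m) (f \<omega>) < 1 / real (Suc n))" for m n
    by (rule borel_measurable_pred_less) simp
  then have meas: "i n \<in> M \<rightarrow>\<^sub>M count_space UNIV" for n
    unfolding i_def[abs_def] by (rule measurable_Least)
  have lim: "(\<lambda>n. e (i n \<omega>)) \<longlonglongrightarrow> f \<omega>" if \<omega>: "\<omega> \<in> space M" for \<omega>
  proof -
    have close: "dist (e (i n \<omega>)) (f \<omega>) < 1 / real (Suc n)" for n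
    proof -
      have "f \<omega> \<in> closure D" using D(2) \<omega> by auto
      then obtain d where d: "d \<in> D" "dist d (f \<omega>) < 1 / real (Suc n)"
        unfolding closure_approachable by (meson of_nat_0_less_iff zero_less_Suc zero_less_divide_1_iff)
      then obtain m where "d = e m"
        using from_nat_into_surj[OF D(1) d(1)] unfolding e_def by blast
      then show ?thesis
        unfolding i_def using d(2) by (intro LeastI[of "\<lambda>m. dist (e m) (f \<omega>) < 1 / real (Suc n)" m]) simp
    qed
    have "(\<lambda>n. dist (e (i n \<omega>)) (f \<omega>)) \<longlonglongrightarrow> 0"
    proof (rule real_tendsto_sandwich[of "\<lambda>_. 0" _ _ "\<lambda>n. 1 / real (Suc n)"])
      show "(\<lambda>n. 1 / real (Suc n)) \<longlonglongrightarrow> 0"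
        using LIMSEQ_inverse_real_of_nat by (simp add: inverse_eq_divide)
      show "\<forall>\<^sub>F n in sequentially. dist (e (i n \<omega>)) (f \<omega>) \<le> 1 / real (Suc n)"
        using close by (intro always_eventually allI less_imp_le)
    qed simp_all
    then show ?thesis
      by (rule tendsto_dist_iff[THEN iffD2])
  qed
  from meas lim show ?thesis by (intro exI conjI allI ballI)
qed

text \<open>A Caratheodory argument. Joint continuity together with Borel measurability would not suffice here,
  because sums and differences of Borel maps into a space that is not separable can fail to be
  measurable. For the countably-valued approximations of \<open>f\<close> there is nothing to prove.\<close>

lemma measurable_strongly_measurable_argument:
  fixes \<Phi> :: "'a::real_normed_vector \<Rightarrow> 'w \<Rightarrow> 'c::metric_space"
  assumes f: "strongly_measurable M f"
    and meas: "\<And>a. \<Phi> a \<in> borel_measurable M"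
    and cont: "\<And>\<omega>. \<omega> \<in> space M \<Longrightarrow> continuous_on UNIV (\<lambda>a. \<Phi> a \<omega>)"
  shows "(\<lambda>\<omega>. \<Phi> (f \<omega>) \<omega>) \<in> borel_measurable M"
proof -
  obtain i :: "nat \<Rightarrow> 'w \<Rightarrow> nat" and e :: "nat \<Rightarrow> 'a"
    where i: "\<And>n. i n \<in> M \<rightarrow>\<^sub>M count_space UNIV"
      and lim: "\<And>\<omega>. \<omega> \<in> space M \<Longrightarrow> (\<lambda>n. e (i n \<omega>)) \<longlonglongrightarrow> f \<omega>"
    using strongly_measurable_approx[OF f] by metis
  show ?thesis
  proof (rule borel_measurable_LIMSEQ_metric)
    show "(\<lambda>\<omega>. \<Phi> (e (i n \<omega>)) \<omega>) \<in> borel_measurable M" for n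
      using meas by (rule measurable_compose_countable[of "\<lambda>m. \<Phi> (e m)", OF _ i])
    show "(\<lambda>n. \<Phi> (e (i n \<omega>)) \<omega>) \<longlonglongrightarrow> \<Phi> (f \<omega>) \<omega>" if "\<omega> \<in> space M" for \<omega>
      by (rule continuous_on_tendsto_compose[OF cont[OF that] lim[OF that]]) auto
  qed
qed

lemma strongly_measurable_combine:
  fixes \<Phi> :: "'a::real_normed_vector \<Rightarrow> 'b::topological_space \<Rightarrow> 'c::metric_space"
  assumes "strongly_measurable M f" and u: "u \<in> borel_measurable M"
    and cont: "\<And>a. continuous_on UNIV (\<Phi> a)" "\<And>b. continuous_on UNIV (\<lambda>a. \<Phi> a b)"
  shows "(\<lambda>\<omega>. \<Phi> (f \<omega>) (u \<omega>)) \<in> borel_measurable M"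
  using measurable_compose[OF u borel_measurable_continuous_onI[OF cont(1)]] cont(2)
  by (rule measurable_strongly_measurable_argument[OF assms(1), of "\<lambda>a \<omega>. \<Phi> a (u \<omega>)"])

lemma strongly_measurable_norm_diff:
  assumes "strongly_measurable M f" "u \<in> borel_measurable M"
  shows "(\<lambda>\<omega>. norm (f \<omega> - u \<omega>)) \<in> borel_measurable M"
  by (rule strongly_measurable_combine[OF assms]) (intro continuous_intros)+

lemma strongly_measurable_add:
  assumes "strongly_measurable M f" "u \<in> borel_measurable M"
  shows "(\<lambda>\<omega>. f \<omega> + u \<omega>) \<in> borel_measurable M"
  by (rule strongly_measurable_combine[OF assms]) (intro continuous_intros)+

lemma strongly_measurable_pairing:
  fixes Y :: "'w \<Rightarrow> ('a::real_normed_vector \<Rightarrow>\<^sub>L real)"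
  assumes "strongly_measurable M f" "\<And>d. (\<lambda>\<omega>. blinfun_apply (Y \<omega>) d) \<in> borel_measurable M"
  shows "(\<lambda>\<omega>. blinfun_apply (Y \<omega>) (f \<omega>)) \<in> borel_measurable M"
  using assms(2)
  by (rule measurable_strongly_measurable_argument[OF assms(1), of "\<lambda>a \<omega>. blinfun_apply (Y \<omega>) a"])
    (intro continuous_intros)

lemma strongly_measurable_compose:
  assumes "strongly_measurable N f" "T \<in> M \<rightarrow>\<^sub>M N"
  shows "strongly_measurable M (\<lambda>x. f (T x))"
proof -
  obtain D where D: "countable D" "f ` space N \<subseteq> closure D"
    using assms unfolding strongly_measurable_def by blast
  have "(\<lambda>x. f (T x)) ` space M \<subseteq> closure D"
    using D(2) measurable_space[OF assms(2)] by blast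
  then show ?thesis
    using assms D(1) unfolding strongly_measurable_def by auto
qed

lemma strongly_measurable_countable_range:
  assumes "i \<in> M \<rightarrow>\<^sub>M count_space (UNIV :: nat set)"
  shows "strongly_measurable M (\<lambda>\<omega>. e (i \<omega>))"
  unfolding strongly_measurable_def
proof
  show "(\<lambda>\<omega>. e (i \<omega>)) \<in> borel_measurable M"
    by (rule measurable_compose[OF assms]) simp
  have "(\<lambda>\<omega>. e (i \<omega>)) ` space M \<subseteq> closure (range e)"
    using closure_subset by fastforce
  then show "\<exists>D. countable D \<and> (\<lambda>\<omega>. e (i \<omega>)) ` space M \<subseteq> closure D"
    by (intro exI[of _ "range e"]) simp
qed

text \<open>The definition of sampling fixes the joint law of the past and the sample on measurable rectangles.
  These generate the product sigma-algebra and are closed under intersection, so the joint law is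
  the composition of the law of the past with the kernel.\<close>

lemma nn_integral_sampled_from:
  assumes X: "sampled_from M G N X \<kappa>" and sub: "subalgebra M G" and M: "prob_space M"
    and f: "f \<in> borel_measurable (G \<Otimes>\<^sub>M N)"
  shows "(\<integral>\<^sup>+\<omega>. f (\<omega>, X \<omega>) \<partial>M) = (\<integral>\<^sup>+\<omega>. (\<integral>\<^sup>+x. f (\<omega>, x) \<partial>\<kappa> \<omega>) \<partial>M)"
proof -
  interpret prob_space M by fact
  let ?GN = "G \<Otimes>\<^sub>M N" and ?R = "restr_to_subalg M G"
  have Xm: "X \<in> M \<rightarrow>\<^sub>M N" and \<kappa>: "\<kappa> \<in> G \<rightarrow>\<^sub>M prob_algebra N"
    and rect: "\<And>B A. B \<in> sets G \<Longrightarrow> A \<in> sets N \<Longrightarrow>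
      emeasure M (B \<inter> (X -` A \<inter> space M)) = (\<integral>\<^sup>+\<omega>\<in>B. emeasure (\<kappa> \<omega>) A \<partial>M)"
    using X unfolding sampled_from_def by auto
  have spG: "space G = space M" and setsG: "sets G \<subseteq> sets M"
    using sub by (auto simp: subalgebra_def)
  have \<kappa>s: "\<kappa> \<in> G \<rightarrow>\<^sub>M subprob_algebra N"
    by (rule measurable_prob_algebraD[OF \<kappa>])
  have sets\<kappa>: "sets (\<kappa> \<omega>) = sets N" if "\<omega> \<in> space M" for \<omega>
    using subprob_measurableD(2)[OF \<kappa>s] that spG by auto
  have idM: "(\<lambda>\<omega>. \<omega>) \<in> M \<rightarrow>\<^sub>M G"
    by (rule measurable_from_subalg[OF sub]) simp
  have pairM: "(\<lambda>\<omega>. (\<omega>, X \<omega>)) \<in> M \<rightarrow>\<^sub>M ?GN"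
    by (rule measurable_Pair[OF idM Xm])
  define k where "k \<omega> = distr (\<kappa> \<omega>) ?GN (Pair \<omega>)" for \<omega>
  have "(\<lambda>\<omega>. distr (\<kappa> \<omega>) ?GN (Pair \<omega>)) \<in> G \<rightarrow>\<^sub>M subprob_algebra ?GN"
    by (rule measurable_distr2[OF _ \<kappa>s]) simp
  moreover have measR: "measurable ?R (subprob_algebra ?GN) = measurable G (subprob_algebra ?GN)"
    by (intro measurable_cong_sets) (simp_all add: sets_restr_to_subalg[OF sub])
  ultimately have k: "k \<in> ?R \<rightarrow>\<^sub>M subprob_algebra ?GN"
    by (simp only: k_def[abs_def])
  have spR: "space ?R = space M" by (simp add: space_restr_to_subalg)
  have pair\<kappa>: "Pair \<omega> \<in> \<kappa> \<omega> \<rightarrow>\<^sub>M ?GN" if "\<omega> \<in> space M" for \<omega>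
    using measurable_Pair1'[of \<omega> G N] that spG by (simp only: measurable_cong_sets[OF sets\<kappa>[OF that] refl])
  have eq: "distr M ?GN (\<lambda>\<omega>. (\<omega>, X \<omega>)) = ?R \<bind> k"
  proof (rule measure_eqI_generator_eq[OF Int_stable_pair_measure_generator[of G N]])
    show "{a \<times> b |a b. a \<in> sets G \<and> b \<in> sets N} \<subseteq> Pow (space G \<times> space N)"
      by (rule pair_measure_closed)
    show "sets (distr M ?GN (\<lambda>\<omega>. (\<omega>, X \<omega>)))
        = sigma_sets (space G \<times> space N) {a \<times> b |a b. a \<in> sets G \<and> b \<in> sets N}"
      by (simp add: sets_pair_measure)
    have "sets (?R \<bind> k) = sets ?GN"
      using not_empty spR by (intro sets_bind) (auto simp: k_def)
    then show "sets (?R \<bind> k) = sigma_sets (space G \<times> space N) {a \<times> b |a b. a \<in> sets G \<and> b \<in> sets N}"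
      by (simp add: sets_pair_measure)
    show "range (\<lambda>_::nat. space G \<times> space N) \<subseteq> {a \<times> b |a b. a \<in> sets G \<and> b \<in> sets N}"
      by auto
    show "emeasure (distr M ?GN (\<lambda>\<omega>. (\<omega>, X \<omega>))) (space G \<times> space N) \<noteq> \<infinity>" for i :: nat
      using pairM by (simp add: emeasure_distr)
    fix E assume "E \<in> {a \<times> b |a b. a \<in> sets G \<and> b \<in> sets N}"
    then obtain a b where E: "E = a \<times> b" and a: "a \<in> sets G" and b: "b \<in> sets N" by auto
    have E': "E \<in> sets ?GN" using a b E by simp
    have aM: "a \<subseteq> space M" using sets.sets_into_space[OF a] spG by simp
    have "emeasure (distr M ?GN (\<lambda>\<omega>. (\<omega>, X \<omega>))) E = emeasure M (a \<inter> (X -` b \<inter> space M))"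
      using aM by (subst emeasure_distr[OF pairM E']) (auto simp: E intro!: arg_cong[of _ _ "emeasure M"])
    also have "\<dots> = (\<integral>\<^sup>+\<omega>\<in>a. emeasure (\<kappa> \<omega>) b \<partial>M)" by (rule rect[OF a b])
    also have "\<dots> = (\<integral>\<^sup>+\<omega>\<in>a. emeasure (\<kappa> \<omega>) b \<partial>?R)"
    proof (rule nn_integral_subalgebra2[OF sub, symmetric])
      have "(\<lambda>\<omega>. emeasure (\<kappa> \<omega>) b) \<in> borel_measurable G"
        by (rule measurable_emeasure_kernel[OF \<kappa>s b])
      then show "(\<lambda>\<omega>. emeasure (\<kappa> \<omega>) b * indicator a \<omega>) \<in> borel_measurable G"
        using a by simp
    qed
    also have "\<dots> = (\<integral>\<^sup>+\<omega>. emeasure (k \<omega>) E \<partial>?R)"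
    proof (rule nn_integral_cong)
      fix \<omega> assume "\<omega> \<in> space ?R"
      then have \<omega>: "\<omega> \<in> space M" by (simp add: spR)
      have "Pair \<omega> -` E \<inter> space (\<kappa> \<omega>) = (if \<omega> \<in> a then b else {})"
        using sets.sets_into_space[OF b] sets_eq_imp_space_eq[OF sets\<kappa>[OF \<omega>]] by (auto simp: E)
      then show "emeasure (\<kappa> \<omega>) b * indicator a \<omega> = emeasure (k \<omega>) E"
        unfolding k_def by (subst emeasure_distr[OF pair\<kappa>[OF \<omega>] E']) (auto simp: indicator_def)
    qed
    also have "\<dots> = emeasure (?R \<bind> k) E"
      using not_empty by (subst emeasure_bind[OF _ k E']) (auto simp: spR)
    finally show "emeasure (distr M ?GN (\<lambda>\<omega>. (\<omega>, X \<omega>))) E = emeasure (?R \<bind> k) E" .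
  qed auto
  have "(\<integral>\<^sup>+\<omega>. f (\<omega>, X \<omega>) \<partial>M) = (\<integral>\<^sup>+y. f y \<partial>distr M ?GN (\<lambda>\<omega>. (\<omega>, X \<omega>)))"
    using f by (intro nn_integral_distr[OF pairM, symmetric]) simp
  also have "\<dots> = (\<integral>\<^sup>+\<omega>. (\<integral>\<^sup>+y. f y \<partial>k \<omega>) \<partial>?R)"
    unfolding eq by (rule nn_integral_bind[OF f k])
  also have "\<dots> = (\<integral>\<^sup>+\<omega>. (\<integral>\<^sup>+x. f (\<omega>, x) \<partial>\<kappa> \<omega>) \<partial>?R)"
    unfolding k_def using spR by (intro nn_integral_cong nn_integral_distr[OF pair\<kappa>]) (use f in auto)
  also have "\<dots> = (\<integral>\<^sup>+\<omega>. (\<integral>\<^sup>+x. f (\<omega>, x) \<partial>\<kappa> \<omega>) \<partial>M)"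
    using f \<kappa>s by (intro nn_integral_subalgebra2[OF sub] nn_integral_measurable_subprob_algebra2[where N = N]) auto
  finally show ?thesis .
qed

text \<open>The positive and the negative part have the same integral against the kernel at every point, hence
  the same integral under the joint law.\<close>

lemma expectation_centred_sample:
  fixes f :: "'w \<times> 'x \<Rightarrow> real"
  assumes X: "sampled_from M G N X \<kappa>" and sub: "subalgebra M G" and M: "prob_space M"
    and f: "f \<in> borel_measurable (G \<Otimes>\<^sub>M N)"
    and centred: "\<And>\<omega>. \<omega> \<in> space M \<Longrightarrow> has_bochner_integral (\<kappa> \<omega>) (\<lambda>x. f (\<omega>, x)) 0"
    and int: "integrable M (\<lambda>\<omega>. f (\<omega>, X \<omega>))"
  shows "(\<integral>\<omega>. f (\<omega>, X \<omega>) \<partial>M) = 0"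
proof -
  have inner: "(\<integral>\<^sup>+x. ennreal (f (\<omega>, x)) \<partial>\<kappa> \<omega>) = (\<integral>\<^sup>+x. ennreal (- f (\<omega>, x)) \<partial>\<kappa> \<omega>)"
    if "\<omega> \<in> space M" for \<omega>
  proof -
    have i: "integrable (\<kappa> \<omega>) (\<lambda>x. f (\<omega>, x))" and "(\<integral>x. f (\<omega>, x) \<partial>\<kappa> \<omega>) = 0"
      using centred[OF that] by (auto simp: has_bochner_integral_iff)
    then have "enn2real (\<integral>\<^sup>+x. ennreal (f (\<omega>, x)) \<partial>\<kappa> \<omega>) = enn2real (\<integral>\<^sup>+x. ennreal (- f (\<omega>, x)) \<partial>\<kappa> \<omega>)"
      by (simp add: real_lebesgue_integral_def)
    then show ?thesis
      using i unfolding real_integrable_def infinity_ennreal_def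
      by (metis ennreal_enn2real less_top)
  qed
  have "(\<integral>\<^sup>+\<omega>. ennreal (f (\<omega>, X \<omega>)) \<partial>M) = (\<integral>\<^sup>+\<omega>. (\<integral>\<^sup>+x. ennreal (f (\<omega>, x)) \<partial>\<kappa> \<omega>) \<partial>M)"
    using f by (intro nn_integral_sampled_from[OF X sub M, where f = "\<lambda>p. ennreal (f p)"]) measurable
  also have "\<dots> = (\<integral>\<^sup>+\<omega>. (\<integral>\<^sup>+x. ennreal (- f (\<omega>, x)) \<partial>\<kappa> \<omega>) \<partial>M)"
    by (intro nn_integral_cong inner)
  also have "\<dots> = (\<integral>\<^sup>+\<omega>. ennreal (- f (\<omega>, X \<omega>)) \<partial>M)"
    using f by (intro nn_integral_sampled_from[OF X sub M, where f = "\<lambda>p. ennreal (- f p)", symmetric]) measurable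
  finally show ?thesis
    by (simp add: real_lebesgue_integral_def[OF int])
qed

section \<open>Lipschitz continuity of the mean operator\<close>

lemma mean_le_root_mean_square:
  fixes f :: "'x \<Rightarrow> real"
  assumes "prob_space Q" and f: "\<And>x. 0 \<le> f x" and int: "integrable Q (\<lambda>x. (f x)\<^sup>2)"
    and le: "(\<integral>x. (f x)\<^sup>2 \<partial>Q) \<le> a\<^sup>2" and a: "0 \<le> a"
  shows "integrable Q f" "(\<integral>x. f x \<partial>Q) \<le> a"
proof -
  interpret prob_space Q by fact
  have "(\<lambda>x. sqrt ((f x)\<^sup>2)) \<in> borel_measurable Q"
    using int by measurable
  then have meas: "f \<in> borel_measurable Q" using f by (simp add: real_sqrt_abs)
  show i: "integrable Q f"
    by (rule square_integrable_imp_integrable[OF meas int])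
  have "(expectation f)\<^sup>2 \<le> expectation (\<lambda>x. (f x)\<^sup>2)"
    using variance_eq[OF i int] variance_positive[of f] by simp
  then have "(expectation f)\<^sup>2 \<le> a\<^sup>2" using le by simp
  then show "expectation f \<le> a" using a by (rule power2_le_imp_le)
qed

text \<open>The mean of \<open>Fo \<xi> u - Fo \<xi> v\<close> is no longer than the mean of the norm, which by Cauchy-Schwarz is at
  most the root of the mean square. This also bounds the mean part of the estimation error, so its
  second moment is at most four times that allowed for \<open>\<Delta>\<close>.\<close>

lemma mean_operator_lipschitz:
  assumes ora: "variable_lipschitz_oracle L A \<Xi> Q Fo F" and L: "L > 0"
    and u: "u \<in> A" and v: "v \<in> A"
  shows "norm (F u - F v) \<le> L * norm (u - v)"
proof (rule norm_blinfun_bound)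
  let ?f = "\<lambda>\<xi>. norm (Fo \<xi> u - Fo \<xi> v)"
  have Q: "prob_space (Q u v)"
    and mean: "\<And>z d. z \<in> A \<Longrightarrow> has_bochner_integral (Q u v) (\<lambda>\<xi>. blinfun_apply (Fo \<xi> z) d) (blinfun_apply (F z) d)"
    and int: "integrable (Q u v) (\<lambda>\<xi>. (?f \<xi>)\<^sup>2)"
    and le: "(\<integral>\<xi>. (?f \<xi>)\<^sup>2 \<partial>Q u v) \<le> L\<^sup>2 * (norm (u - v))\<^sup>2"
    using ora u v unfolding variable_lipschitz_oracle_def has_dual_expectation_def
    by (auto simp: space_prob_algebra)
  have f: "integrable (Q u v) ?f" "(\<integral>\<xi>. ?f \<xi> \<partial>Q u v) \<le> L * norm (u - v)"
    using mean_le_root_mean_square[OF Q _ int, of "L * norm (u - v)"] le L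
    by (auto simp: power_mult_distrib)
  show "0 \<le> L * norm (u - v)" using L by simp
  show "norm (blinfun_apply (F u - F v) d) \<le> L * norm (u - v) * norm d" for d
  proof -
    have "has_bochner_integral (Q u v) (\<lambda>\<xi>. blinfun_apply (Fo \<xi> u - Fo \<xi> v) d) (blinfun_apply (F u - F v) d)"
      unfolding blinfun.diff_left by (intro has_bochner_integral_diff mean u v)
    then have i: "integrable (Q u v) (\<lambda>\<xi>. blinfun_apply (Fo \<xi> u - Fo \<xi> v) d)"
      and e: "blinfun_apply (F u - F v) d = (\<integral>\<xi>. blinfun_apply (Fo \<xi> u - Fo \<xi> v) d \<partial>Q u v)"
      by (auto simp: has_bochner_integral_iff)
    have "norm (blinfun_apply (F u - F v) d) \<le> (\<integral>\<xi>. norm (blinfun_apply (Fo \<xi> u - Fo \<xi> v) d) \<partial>Q u v)"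
      unfolding e by (rule integral_norm_bound)
    also have "\<dots> \<le> (\<integral>\<xi>. ?f \<xi> * norm d \<partial>Q u v)"
      using i f(1) by (intro integral_mono integrable_norm norm_blinfun) auto
    also have "\<dots> \<le> L * norm (u - v) * norm d"
      using f(2) by (simp add: mult_right_mono)
    finally show ?thesis .
  qed
qed

section \<open>Dual averaging\<close>

text \<open>Total boundedness of \<open>C\<close> gives finitely many balls of each radius \<open>1/(n + 1)\<close>; pick a point of \<open>T\<close> in each
  ball that meets it.\<close>

lemma countable_dense_subset_of_compact:
  fixes T :: "'a::metric_space set"
  assumes "compact C" "T \<subseteq> C"
  shows "\<exists>Z. countable Z \<and> Z \<subseteq> T \<and> T \<subseteq> closure Z"
proof -
  have "\<exists>k. finite k \<and> C \<subseteq> (\<Union>c\<in>k. ball c (1 / real (Suc n)))" for n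
    using assms(1) unfolding compact_eq_totally_bounded by simp
  then obtain k where "\<forall>n. finite (k n) \<and> C \<subseteq> (\<Union>c\<in>k n. ball c (1 / real (Suc n)))"
    using choice[of "\<lambda>n k. finite k \<and> C \<subseteq> (\<Union>c\<in>k. ball c (1 / real (Suc n)))"] by blast
  then have k: "finite (k n)" "C \<subseteq> (\<Union>c\<in>k n. ball c (1 / real (Suc n)))" for n
    by auto
  define p where "p n c = (SOME t. t \<in> T \<inter> ball c (1 / real (Suc n)))" for n c
  define Z where "Z = T \<inter> (\<Union>n. p n ` k n)"
  have "countable (\<Union>n. p n ` k n)"
    by (rule countable_UN) (simp_all add: countable_finite k(1))
  then have "countable Z"
    unfolding Z_def by (rule countable_subset[rotated]) blast
  moreover have "T \<subseteq> closure Z"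
  proof
    fix t assume t: "t \<in> T"
    show "t \<in> closure Z"
      unfolding closure_approachable
    proof (intro allI impI)
      fix e :: real assume "e > 0"
      then obtain n where n: "1 / real (Suc n) < e / 2"
        using nat_approx_posE[of "e / 2"] by (metis half_gt_zero)
      obtain c where c: "c \<in> k n" "t \<in> ball c (1 / real (Suc n))"
        using k(2)[of n] t assms(2) by blast
      then have "p n c \<in> T \<inter> ball c (1 / real (Suc n))"
        unfolding p_def using t
        by (intro someI_ex[of "\<lambda>t. t \<in> T \<inter> ball c (1 / real (Suc n))"]) blast
      then have p: "p n c \<in> T" "dist c (p n c) < 1 / real (Suc n)" by simp_all
      have "p n c \<in> Z" unfolding Z_def using p(1) c(1) by blast
      moreover have "dist (p n c) t < e"
      proof -
        have "dist c t < e / 2" "dist c (p n c) < e / 2"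
          using c(2) p(2) n by simp_all
        then show ?thesis
          using dist_triangle2[of "p n c" t c] by (simp add: dist_commute)
      qed
      ultimately show "\<exists>y\<in>Z. dist y t < e" by blast
    qed
  qed
  moreover have "Z \<subseteq> T" unfolding Z_def by blast
  ultimately show ?thesis using \<open>countable Z\<close> by blast
qed

text \<open>Midpoints are all the convexity that \<open>dual_averaging_step\<close> uses, and closing a set under a
  single binary operation keeps it countable.\<close>

lemma countable_midpoint_closure:
  fixes Z :: "'a::real_vector set"
  assumes "countable Z"
  shows "\<exists>A. countable A \<and> Z \<subseteq> A \<and> A \<subseteq> convex hull Z \<and>
    (\<forall>x\<in>A. \<forall>y\<in>A. (1 - 1 / 2 :: real) *\<^sub>R x + (1 / 2 :: real) *\<^sub>R y \<in> A)"
proof -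
  define m where "m = (\<lambda>(x :: 'a, y). (1 - 1 / 2 :: real) *\<^sub>R x + (1 / 2 :: real) *\<^sub>R y)"
  define B where "B = rec_nat Z (\<lambda>_ B. B \<union> m ` (B \<times> B))"
  have B_0: "B 0 = Z" and B_Suc: "B (Suc n) = B n \<union> m ` (B n \<times> B n)" for n
    by (simp_all add: B_def)
  have inc: "B i \<subseteq> B j" if "i \<le> j" for i j
    using that by (rule lift_Suc_mono_le[of B, rotated]) (simp add: B_Suc)
  have cnt: "countable (B n)" for n
    by (induction n) (simp_all add: B_0 B_Suc assms)
  have hull: "B n \<subseteq> convex hull Z" for n
  proof (induction n)
    case 0
    then show ?case by (simp add: B_0 hull_subset)
  next
    case (Suc n)
    have "m ` (B n \<times> B n) \<subseteq> convex hull Z"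
    proof (rule image_subsetI)
      fix p assume "p \<in> B n \<times> B n"
      then have "fst p \<in> convex hull Z" "snd p \<in> convex hull Z" using Suc by auto
      then show "m p \<in> convex hull Z"
        unfolding m_def case_prod_beta by (intro convexD[OF convex_convex_hull]) auto
    qed
    then show ?case using Suc by (simp add: B_Suc)
  qed
  have mid: "m (x, y) \<in> (\<Union>n. B n)" if xy: "x \<in> (\<Union>n. B n)" "y \<in> (\<Union>n. B n)" for x y
  proof -
    obtain i j where "x \<in> B i" "y \<in> B j" using xy by blast
    then have "x \<in> B (max i j)" "y \<in> B (max i j)"
      using inc[of i "max i j"] inc[of j "max i j"] by auto
    then have "m (x, y) \<in> B (Suc (max i j))" by (simp add: B_Suc)
    then show ?thesis by blast
  qed
  show ?thesis
  proof (intro exI[of _ "\<Union>n. B n"] conjI ballI)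
    show "countable (\<Union>n. B n)" by (rule countable_UN) (simp_all add: cnt)
    show "Z \<subseteq> (\<Union>n. B n)" using B_0 by blast
    show "(\<Union>n. B n) \<subseteq> convex hull Z" using hull by blast
    show "(1 - 1 / 2 :: real) *\<^sub>R x + (1 / 2 :: real) *\<^sub>R y \<in> (\<Union>n. B n)"
      if "x \<in> (\<Union>n. B n)" "y \<in> (\<Union>n. B n)" for x y
      using mid[OF that] by (simp only: m_def case_prod_conv)
  qed
qed

context prox_geometry
begin

text \<open>Let \<open>\<phi>\<^sub>U a = \<langle>U, a - c\<rangle> - D a c\<close>. If \<open>x\<close> maximises \<open>\<phi>\<^sub>U\<close> on \<open>A\<close> up to \<open>\<epsilon>\<close>, the value at the midpoint
  of \<open>x\<close> and \<open>a\<close> cannot exceed that at \<open>x\<close> by more than \<open>\<epsilon>\<close>, so strong concavity yields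
  \<open>\<phi>\<^sub>U a \<le> \<phi>\<^sub>U x + 2 \<epsilon> - |x - a|\<^sup>2/4\<close>. The quadratic term absorbs \<open>\<langle>v, a - x\<rangle>\<close> at the price \<open>|v|\<^sup>2\<close>.\<close>

lemma dual_averaging_step:
  assumes A: "A \<subseteq> eff_dom g"
    and mid: "\<And>x y. x \<in> A \<Longrightarrow> y \<in> A \<Longrightarrow> (1 - 1 / 2 :: real) *\<^sub>R x + (1 / 2 :: real) *\<^sub>R y \<in> A"
    and x: "x \<in> A" "\<And>a. a \<in> A \<Longrightarrow> blinfun_apply U (a - c) - D a c \<le> blinfun_apply U (x - c) - D x c + \<epsilon>"
    and a: "a \<in> A"
  shows "blinfun_apply (U + v) (a - c) - D a c
    \<le> (blinfun_apply U (x - c) - D x c) + (2 * \<epsilon> + blinfun_apply v (x - c) + (norm v)\<^sup>2)"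
proof -
  define m where "m = (1 - 1 / 2 :: real) *\<^sub>R x + (1 / 2 :: real) *\<^sub>R a"
  have m: "m \<in> A" unfolding m_def by (rule mid[OF x(1) a])
  have mc: "m - c = (1 / 2) *\<^sub>R (x - c) + (1 / 2) *\<^sub>R (a - c)"
    by (simp add: m_def algebra_simps scaleR_left_distrib[symmetric])
  have lin: "2 * blinfun_apply p (m - c) = blinfun_apply p (x - c) + blinfun_apply p (a - c)" for p :: "'a \<Rightarrow>\<^sub>L real"
    unfolding mc blinfun.add_right blinfun.scaleR_right by simp
  have "hR m \<le> (1 - 1 / 2) * hR x + 1 / 2 * hR a - 1 / 2 * (1 - 1 / 2) * ((norm (x - a))\<^sup>2 / 2)"
    unfolding m_def using A x(1) a by (intro hR_strongly_convex) auto
  then have "2 * D m c \<le> D x c + D a c - (norm (x - a))\<^sup>2 / 4"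
    using lin[of "gradient h c"] by (simp add: D_def)
  then have 1: "blinfun_apply U (a - c) - D a c \<le> blinfun_apply U (x - c) - D x c + 2 * \<epsilon> - (norm (x - a))\<^sup>2 / 4"
    using x(2)[OF m] lin[of U] by simp
  have "blinfun_apply v (a - x) \<le> norm v * norm (x - a)"
    using norm_blinfun[of v "a - x"] by (simp add: norm_minus_commute)
  also have "\<dots> \<le> (norm v)\<^sup>2 + (norm (x - a))\<^sup>2 / 4"
    using sum_squares_bound[of "norm v" "norm (x - a) / 2"] by (simp add: power_divide)
  finally show ?thesis
    using 1 by (simp add: blinfun.add_left blinfun.diff_right)
qed

text \<open>The supremum of \<open>a \<mapsto> \<langle>U, a - c\<rangle> - D a c\<close> is the conjugate of \<open>D _ c\<close> at \<open>U\<close>; it starts at a value \<open>\<le> 0\<close>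
  and grows by one \<open>dual_averaging_step\<close> per summand of \<open>U\<close>.\<close>

lemma dual_averaging_regret:
  fixes v :: "nat \<Rightarrow> ('a \<Rightarrow>\<^sub>L real)" and x :: "nat \<Rightarrow> 'a"
  assumes A: "A \<subseteq> eff_dom g"
    and mid: "\<And>x y. x \<in> A \<Longrightarrow> y \<in> A \<Longrightarrow> (1 - 1 / 2 :: real) *\<^sub>R x + (1 / 2 :: real) *\<^sub>R y \<in> A"
    and c: "c \<in> dom_subdiff h"
    and x: "\<And>n. x n \<in> A"
      "\<And>n a. a \<in> A \<Longrightarrow> blinfun_apply (\<Sum>j<n. v j) (a - c) - D a c
         \<le> blinfun_apply (\<Sum>j<n. v j) (x n - c) - D (x n) c + \<epsilon>"
    and a: "a \<in> A"
  shows "blinfun_apply (\<Sum>j<n. v j) (a - c) - D a c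
    \<le> (\<Sum>j<n. 2 * \<epsilon> + blinfun_apply (v j) (x j - c) + (norm (v j))\<^sup>2)"
  using a
proof (induction n arbitrary: a)
  case 0
  then show ?case using D_nonneg[OF _ c, of a] A dom_gh by auto
next
  case (Suc n)
  show ?case
    using dual_averaging_step[OF A mid x(1)[of n] x(2)[of _ n] Suc.prems, of "v n"] Suc.IH[OF x(1)[of n]]
    by simp
qed

end

section \<open>Sample paths\<close>

text \<open>The points averaged to obtain \<open>w s\<close> and, through their gradients, \<open>wbar s\<close>: the iterates of
  the previous epoch, and copies of \<open>z0\<close> before the first one.\<close>

definition anchor :: "'a \<Rightarrow> (nat \<Rightarrow> nat \<Rightarrow> 'a) \<Rightarrow> nat \<Rightarrow> nat \<Rightarrow> 'a" where
  "anchor z0 z s j = (case s of 0 \<Rightarrow> z0 | Suc s' \<Rightarrow> z s' (Suc j))"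

text \<open>The error \<open>F u\<close> minus the variance-reduced estimate of it; this is the mean of \<open>Fo x u - Fo x v\<close> over
  \<open>x\<close> minus its value.\<close>

definition noise :: "('a::real_normed_vector \<Rightarrow> ('a \<Rightarrow>\<^sub>L real)) \<Rightarrow> ('x \<Rightarrow> 'a \<Rightarrow> ('a \<Rightarrow>\<^sub>L real)) \<Rightarrow>
    'x \<Rightarrow> 'a \<Rightarrow> 'a \<Rightarrow> ('a \<Rightarrow>\<^sub>L real)" where
  "noise F Fo x u v = F u - F v - (Fo x u - Fo x v)"

lemma sum_double_index:
  fixes f :: "nat \<Rightarrow> nat \<Rightarrow> 'b::comm_monoid_add"
  shows "(\<Sum>s<S. \<Sum>k<K. f s k) = (\<Sum>n<S * K. f (n div K) (n mod K))"
  unfolding sum_mult_product by (intro sum.cong) auto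

lemma sum_shift_one: "(\<Sum>k=1..K. f k) = (\<Sum>j<K. f (Suc j))" for f :: "nat \<Rightarrow> 'b::comm_monoid_add"
  by (rule sum.reindex_bij_witness[of _ Suc "\<lambda>k. k - 1"]) auto

locale mp_run = prox_geometry g h
  for g h :: "'a::real_normed_vector \<Rightarrow> ereal" +
  fixes F :: "'a \<Rightarrow> ('a \<Rightarrow>\<^sub>L real)" and Fo :: "'x \<Rightarrow> 'a \<Rightarrow> ('a \<Rightarrow>\<^sub>L real)"
    and \<alpha> \<tau> :: real and K :: nat and z0 :: 'a and \<xi> :: "nat \<Rightarrow> nat \<Rightarrow> 'x"
    and z zh :: "nat \<Rightarrow> nat \<Rightarrow> 'a" and w wbar :: "nat \<Rightarrow> 'a"
  assumes run: "mirror_prox_vr_run g h F Fo \<alpha> \<tau> K z0 \<xi> z zh w wbar"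
    and \<tau>_pos: "\<tau> > 0" and \<alpha>_range: "0 \<le> \<alpha>" "\<alpha> \<le> 1" and K_pos: "K > 0" and z0_dom: "z0 \<in> eff_dom g"
begin

lemma z_subdiff: "k \<le> K \<Longrightarrow> z s k \<in> dom_subdiff h"
  and wbar_subdiff: "wbar s \<in> dom_subdiff h"
  and zh_prox: "k < K \<Longrightarrow> is_arg_min (prox_objective g h \<alpha> \<tau> (F (w s)) (z s k) (wbar s)) (\<lambda>_. True) (zh s k)"
  and z_prox: "k < K \<Longrightarrow> is_arg_min (prox_objective g h \<alpha> \<tau>
      (F (w s) + Fo (\<xi> s k) (zh s k) - Fo (\<xi> s k) (w s)) (z s k) (wbar s)) (\<lambda>_. True) (z s (Suc k))"
  and z_start: "z 0 0 = z0" "z (Suc s) 0 = z s K"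
  and w_start: "w 0 = z0" "wbar 0 = z0"
  and w_Suc: "w (Suc s) = (1 / real K) *\<^sub>R (\<Sum>k=1..K. z s k)"
  and wbar_Suc: "gradient h (wbar (Suc s)) = (1 / real K) *\<^sub>R (\<Sum>k=1..K. gradient h (z s k))"
  using run unfolding mirror_prox_vr_run_def by auto

lemma zh_dom: "k < K \<Longrightarrow> zh s k \<in> eff_dom g"
  by (rule prox_minimizer(1)[OF zh_prox \<tau>_pos \<alpha>_range z_subdiff wbar_subdiff]) auto

lemma z_Suc_dom: "k < K \<Longrightarrow> z s (Suc k) \<in> eff_dom g"
  by (rule prox_minimizer(1)[OF z_prox \<tau>_pos \<alpha>_range z_subdiff wbar_subdiff]) auto

lemma anchor_Suc: "anchor z0 z (Suc s) j = z s (Suc j)"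
  by (simp add: anchor_def)

lemma anchor_dom: "j < K \<Longrightarrow> anchor z0 z s j \<in> dom_subdiff h \<inter> eff_dom g"
  using z_subdiff[of 0 0] z_start z0_dom z_subdiff z_Suc_dom by (cases s) (auto simp: anchor_def)

lemma w_anchor: "w s = (1 / real K) *\<^sub>R (\<Sum>j<K. anchor z0 z s j)"
proof (cases s)
  case 0
  then show ?thesis using K_pos by (simp add: w_start anchor_def sum_constant_scaleR)
next
  case (Suc s')
  then show ?thesis by (simp only: w_Suc anchor_Suc sum_shift_one)
qed

lemma wbar_anchor: "gradient h (wbar s) = (1 / real K) *\<^sub>R (\<Sum>j<K. gradient h (anchor z0 z s j))"
proof (cases s)
  case 0
  then show ?thesis using K_pos by (simp add: w_start anchor_def sum_constant_scaleR)
next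
  case (Suc s')
  then show ?thesis by (simp only: wbar_Suc anchor_Suc sum_shift_one)
qed

lemma w_dom: "w s \<in> eff_dom g"
proof -
  have "(\<Sum>j<K. (1 / real K) *\<^sub>R anchor z0 z s j) \<in> eff_dom g"
    using anchor_dom K_pos by (intro convex_sum convex_dom_g) auto
  then show ?thesis by (simp add: w_anchor scaleR_sum_right)
qed

text \<open>In \<open>extragradient_step\<close> replace \<open>D u b - D zh b\<close>, with \<open>b = wbar s\<close>, by its mean over the anchors. The
  subtracted mean is at least \<open>|zh - w|\<^sup>2/2\<close> by \<open>mean_square_le_mean_D\<close>.\<close>

lemma inner_step_bound:
  assumes k: "k < K" and u: "u \<in> eff_dom g"
  shows "\<tau> * (blinfun_apply (F (zh s k)) (zh s k - u) + gR (zh s k) - gR u) + D u (z s (Suc k))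
    \<le> \<alpha> * D u (z s k) + (1 - \<alpha>) * ((1 / real K) * (\<Sum>j<K. D u (anchor z0 z s j)))
      + (\<tau> * blinfun_apply (noise F Fo (\<xi> s k) (zh s k) (w s)) (zh s k - u)
        + \<tau>\<^sup>2 / 2 * (norm (Fo (\<xi> s k) (zh s k) - Fo (\<xi> s k) (w s)))\<^sup>2
        - (1 - \<alpha>) / 2 * (norm (zh s k - w s))\<^sup>2)"
proof -
  let ?q = "F (w s) + Fo (\<xi> s k) (zh s k) - Fo (\<xi> s k) (w s)"
  have 1: "\<tau> * (blinfun_apply ?q (zh s k - u) + gR (zh s k) - gR u) + D u (z s (Suc k))
    \<le> \<alpha> * D u (z s k) + (1 - \<alpha>) * (D u (wbar s) - D (zh s k) (wbar s))
      + \<tau>\<^sup>2 / 2 * (norm (Fo (\<xi> s k) (zh s k) - Fo (\<xi> s k) (w s)))\<^sup>2"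
    using extragradient_step[OF zh_prox[OF k] z_prox[OF k] \<tau>_pos \<alpha>_range z_subdiff wbar_subdiff z_subdiff u] k
    by (simp add: algebra_simps)
  have "D u (wbar s) - D (zh s k) (wbar s) \<le> (1 / real K) * (\<Sum>j<K. D u (anchor z0 z s j)) - (norm (zh s k - w s))\<^sup>2 / 2"
    using mean_gradient[OF wbar_anchor K_pos, of u s "zh s k"] K_pos
      mean_square_le_mean_D[where y = "anchor z0 z s", OF K_pos anchor_dom zh_dom[OF k]]
    by (simp add: w_anchor[symmetric] sum_subtractf diff_divide_distrib)
  from mult_left_mono[OF this, of "1 - \<alpha>"]
  have 2: "(1 - \<alpha>) * (D u (wbar s) - D (zh s k) (wbar s))
    \<le> (1 - \<alpha>) * ((1 / real K) * (\<Sum>j<K. D u (anchor z0 z s j))) - (1 - \<alpha>) / 2 * (norm (zh s k - w s))\<^sup>2"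
    using \<alpha>_range by (simp add: algebra_simps)
  have "blinfun_apply (F (zh s k)) (zh s k - u)
      = blinfun_apply ?q (zh s k - u) + blinfun_apply (noise F Fo (\<xi> s k) (zh s k) (w s)) (zh s k - u)"
    by (simp add: noise_def blinfun.add_left blinfun.diff_left)
  then have "\<tau> * (blinfun_apply (F (zh s k)) (zh s k - u) + gR (zh s k) - gR u)
      = \<tau> * (blinfun_apply ?q (zh s k - u) + gR (zh s k) - gR u)
        + \<tau> * blinfun_apply (noise F Fo (\<xi> s k) (zh s k) (w s)) (zh s k - u)"
    by (simp only: distrib_left right_diff_distrib)
  then show ?thesis using 1 2 by linarith
qed

text \<open>The potential of an epoch is \<open>\<alpha> D u (z s 0) + (1 - \<alpha>) \<Sum>j. D u (anchor s j)\<close>. Within an epoch the terms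
  \<open>\<alpha> D u z\<^sub>k - D u z\<^bsub>k+1\<^esub>\<close> telescope up to \<open>- (1 - \<alpha>) D u z\<^bsub>k+1\<^esub>\<close>, and the points \<open>z\<^bsub>k+1\<^esub>\<close> are the anchors
  of the next epoch.\<close>

lemma epochs_telescope:
  assumes u: "u \<in> eff_dom g"
    and step: "\<And>s k. k < K \<Longrightarrow> T s k + D u (z s (Suc k))
      \<le> \<alpha> * D u (z s k) + (1 - \<alpha>) * ((1 / real K) * (\<Sum>j<K. D u (anchor z0 z s j))) + E s k"
  shows "(\<Sum>s<S. \<Sum>k<K. T s k) \<le> (\<alpha> + real K * (1 - \<alpha>)) * D u z0 + (\<Sum>s<S. \<Sum>k<K. E s k)"
proof -
  define \<Phi> where "\<Phi> s = \<alpha> * D u (z s 0) + (1 - \<alpha>) * (\<Sum>j<K. D u (anchor z0 z s j))" for s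
  have epoch: "(\<Sum>k<K. T s k) \<le> \<Phi> s - \<Phi> (Suc s) + (\<Sum>k<K. E s k)" for s
  proof -
    let ?a = "\<lambda>s. (\<Sum>j<K. D u (anchor z0 z s j))"
    have "(\<Sum>k<K. T s k + D u (z s (Suc k))) \<le> (\<Sum>k<K. \<alpha> * D u (z s k) + (1 - \<alpha>) * ((1 / real K) * ?a s) + E s k)"
      using step by (intro sum_mono) auto
    also have "\<dots> = \<alpha> * (\<Sum>k<K. D u (z s k)) + (1 - \<alpha>) * ?a s + (\<Sum>k<K. E s k)"
      using K_pos by (simp add: sum.distrib sum_distrib_left)
    finally have 1: "(\<Sum>k<K. T s k) + ?a (Suc s) \<le> \<alpha> * (\<Sum>k<K. D u (z s k)) + (1 - \<alpha>) * ?a s + (\<Sum>k<K. E s k)"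
      by (simp add: sum.distrib anchor_Suc)
    have "(\<Sum>k<K. D u (z s k)) = D u (z s 0) - D u (z s K) + ?a (Suc s)"
      using sum_lessThan_telescope[of "\<lambda>k. D u (z s k)" K] by (simp add: sum_subtractf anchor_Suc)
    with 1 show ?thesis
      by (simp add: \<Phi>_def z_start algebra_simps)
  qed
  have "(\<Sum>s<S. \<Sum>k<K. T s k) \<le> \<Phi> 0 - \<Phi> S + (\<Sum>s<S. \<Sum>k<K. E s k)"
  proof (induction S)
    case (Suc S)
    then show ?case using epoch[of S] by simp
  qed simp
  moreover have "0 \<le> \<Phi> S"
    unfolding \<Phi>_def using \<alpha>_range u dom_gh z_subdiff anchor_dom
    by (intro add_nonneg_nonneg mult_nonneg_nonneg sum_nonneg D_nonneg) auto
  moreover have "\<Phi> 0 = (\<alpha> + real K * (1 - \<alpha>)) * D u z0"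
    by (simp add: \<Phi>_def z_start anchor_def algebra_simps)
  ultimately show ?thesis by simp
qed

lemma average_dom:
  assumes S: "S > 0"
  shows "(1 / (real K * real S)) *\<^sub>R (\<Sum>s<S. \<Sum>k<K. zh s k) \<in> eff_dom g"
    and "gR ((1 / (real K * real S)) *\<^sub>R (\<Sum>s<S. \<Sum>k<K. zh s k)) \<le> (1 / (real K * real S)) * (\<Sum>s<S. \<Sum>k<K. gR (zh s k))"
proof -
  let ?I = "{..<S * K}" and ?c = "1 / (real K * real S)" and ?y = "\<lambda>n. zh (n div K) (n mod K)"
  have y: "?y n \<in> eff_dom g" for n
    by (rule zh_dom) (simp add: K_pos)
  have c: "(\<Sum>n\<in>?I. ?c) = 1" using K_pos S by simp
  have I: "finite ?I" "?I \<noteq> {}" using K_pos S by (auto simp: lessThan_empty_iff)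
  have "(\<Sum>n\<in>?I. ?c *\<^sub>R ?y n) \<in> eff_dom g"
    using c y by (intro convex_sum convex_dom_g) auto
  then show "?c *\<^sub>R (\<Sum>s<S. \<Sum>k<K. zh s k) \<in> eff_dom g"
    by (simp add: sum_double_index scaleR_sum_right)
  have "gR (\<Sum>n\<in>?I. ?c *\<^sub>R ?y n) \<le> (\<Sum>n\<in>?I. ?c * gR (?y n))"
    using c y by (intro convex_on_sum[OF I gR_convex_on]) auto
  then show "gR (?c *\<^sub>R (\<Sum>s<S. \<Sum>k<K. zh s k)) \<le> ?c * (\<Sum>s<S. \<Sum>k<K. gR (zh s k))"
    by (simp add: sum_double_index scaleR_sum_right sum_distrib_left)
qed

text \<open>Monotonicity trades \<open>F (zh s k)\<close> for \<open>F u\<close>, which does not depend on the step, and Jensen's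
  inequality for \<open>g\<close> passes to the average of the half steps.\<close>

lemma gap_bound:
  assumes mono: "monotone_operator_on (eff_dom g) F" and S: "S > 0" and u: "u \<in> eff_dom g"
  defines "zS \<equiv> (1 / (real K * real S)) *\<^sub>R (\<Sum>s<S. \<Sum>k<K. zh s k)"
  shows "\<tau> * real (S * K) * (blinfun_apply (F u) (zS - u) + gR zS - gR u)
    \<le> (\<alpha> + real K * (1 - \<alpha>)) * D u z0
      + (\<Sum>s<S. \<Sum>k<K. \<tau> * blinfun_apply (noise F Fo (\<xi> s k) (zh s k) (w s)) (zh s k - u)
        + \<tau>\<^sup>2 / 2 * (norm (Fo (\<xi> s k) (zh s k) - Fo (\<xi> s k) (w s)))\<^sup>2
        - (1 - \<alpha>) / 2 * (norm (zh s k - w s))\<^sup>2)"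
proof -
  let ?T = "\<lambda>s k. blinfun_apply (F u) (zh s k - u) + gR (zh s k) - gR u"
  let ?N = "real K * real S"
  have N: "?N > 0" using S K_pos by simp
  have "\<tau> * ?T s k \<le> \<tau> * (blinfun_apply (F (zh s k)) (zh s k - u) + gR (zh s k) - gR u)" if "k < K" for s k
  proof -
    have "0 \<le> blinfun_apply (F (zh s k) - F u) (zh s k - u)"
      using mono zh_dom[OF that] u unfolding monotone_operator_on_def by blast
    then show ?thesis using \<tau>_pos by (simp add: blinfun.diff_left)
  qed
  note weaken = this
  have T: "(\<Sum>s<S. \<Sum>k<K. \<tau> * ?T s k) \<le> (\<alpha> + real K * (1 - \<alpha>)) * D u z0
      + (\<Sum>s<S. \<Sum>k<K. \<tau> * blinfun_apply (noise F Fo (\<xi> s k) (zh s k) (w s)) (zh s k - u)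
        + \<tau>\<^sup>2 / 2 * (norm (Fo (\<xi> s k) (zh s k) - Fo (\<xi> s k) (w s)))\<^sup>2
        - (1 - \<alpha>) / 2 * (norm (zh s k - w s))\<^sup>2)"
    by (rule epochs_telescope[OF u]) (rule order_trans[OF add_right_mono[OF weaken] inner_step_bound[OF _ u]])
  have "?N * gR zS \<le> (\<Sum>s<S. \<Sum>k<K. gR (zh s k))"
    using average_dom(2)[OF S] N unfolding zS_def by (simp add: pos_le_divide_eq mult.commute)
  moreover have "?N * blinfun_apply (F u) (zS - u) = (\<Sum>s<S. \<Sum>k<K. blinfun_apply (F u) (zh s k - u))"
    using N by (simp add: zS_def blinfun.diff_right blinfun.scaleR_right blinfun.sum_right sum_subtractf right_diff_distrib mult.commute)
  moreover have "(\<Sum>s<S. \<Sum>k<K. ?T s k) = (\<Sum>s<S. \<Sum>k<K. blinfun_apply (F u) (zh s k - u))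
      + (\<Sum>s<S. \<Sum>k<K. gR (zh s k)) - ?N * gR u"
    by (simp add: sum.distrib sum_subtractf mult.commute)
  ultimately have "?N * (blinfun_apply (F u) (zS - u) + gR zS - gR u) \<le> (\<Sum>s<S. \<Sum>k<K. ?T s k)"
    by (simp add: distrib_left right_diff_distrib)
  then have "\<tau> * (?N * (blinfun_apply (F u) (zS - u) + gR zS - gR u)) \<le> \<tau> * (\<Sum>s<S. \<Sum>k<K. ?T s k)"
    using \<tau>_pos by simp
  with T show ?thesis
    by (simp add: sum_distrib_left mult.assoc mult.left_commute mult.commute)
qed

text \<open>At a solution \<open>u\<close> the gap terms are nonnegative and can be dropped, which gives bounds by the
  distances from \<open>u\<close> to earlier iterates and by the noise. They serve only to propagate
  integrability, so the constants do not matter.\<close>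

lemma step_at_solution:
  assumes mono: "monotone_operator_on (eff_dom g) F" and sol: "u \<in> vi_solutions F g" and k: "k < K"
    and lip: "norm (F u - F (w s)) \<le> L * norm (u - w s)"
  shows "D u (z s (Suc k)) \<le> \<alpha> * D u (z s k) + (1 - \<alpha>) * ((1 / real K) * (\<Sum>j<K. D u (anchor z0 z s j)))
      + (\<tau> * (norm (noise F Fo (\<xi> s k) (zh s k) (w s)) * norm (zh s k - u))
        + \<tau>\<^sup>2 / 2 * (norm (Fo (\<xi> s k) (zh s k) - Fo (\<xi> s k) (w s)))\<^sup>2)"
    and "(norm (zh s k - u))\<^sup>2 / 4 \<le> \<alpha> * D u (z s k)
      + (1 - \<alpha>) * ((1 / real K) * (\<Sum>j<K. D u (anchor z0 z s j))) + \<tau>\<^sup>2 * L\<^sup>2 * (norm (u - w s))\<^sup>2"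
    and "(norm (u - w s))\<^sup>2 / 2 \<le> (1 / real K) * (\<Sum>j<K. D u (anchor z0 z s j))"
proof -
  have u: "u \<in> eff_dom g" using sol by (simp add: vi_solutions_def)
  let ?zh = "zh s k"
  have "0 \<le> ereal (blinfun_apply (F u) (?zh - u)) + g ?zh - g u"
    using sol by (simp add: vi_solutions_def)
  then have vi: "0 \<le> blinfun_apply (F u) (?zh - u) + gR ?zh - gR u"
    using u zh_dom[OF k] by (simp add: g_real)
  have pair: "blinfun_apply p (?zh - u) \<le> norm p * norm (?zh - u)" for p
    using norm_blinfun[of p "?zh - u"] by simp
  show "(norm (u - w s))\<^sup>2 / 2 \<le> (1 / real K) * (\<Sum>j<K. D u (anchor z0 z s j))"
    using mean_square_le_mean_D[where y = "anchor z0 z s", OF K_pos anchor_dom u] by (simp add: w_anchor)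
  \<comment> \<open>Test the half step at \<open>u\<close>: the solution property replaces \<open>F (w s)\<close> by \<open>F (w s) - F u\<close>, which is Lipschitz.\<close>
  show "(norm (?zh - u))\<^sup>2 / 4 \<le> \<alpha> * D u (z s k)
      + (1 - \<alpha>) * ((1 / real K) * (\<Sum>j<K. D u (anchor z0 z s j))) + \<tau>\<^sup>2 * L\<^sup>2 * (norm (u - w s))\<^sup>2"
  proof -
    have 1: "(norm (u - ?zh))\<^sup>2 / 2 + \<alpha> * (D ?zh (z s k) - D u (z s k)) + (1 - \<alpha>) * (D ?zh (wbar s) - D u (wbar s))
      \<le> \<tau> * (blinfun_apply (F (w s)) (u - ?zh) + gR u - gR ?zh)"
      using k by (intro prox_quadratic_growth[OF zh_prox \<tau>_pos \<alpha>_range z_subdiff wbar_subdiff u]) auto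
    have "0 \<le> \<alpha> * D ?zh (z s k)" "0 \<le> (1 - \<alpha>) * D ?zh (wbar s)"
      using \<alpha>_range k zh_dom dom_gh by (auto intro!: mult_nonneg_nonneg D_nonneg z_subdiff wbar_subdiff)
    moreover have "(1 - \<alpha>) * D u (wbar s) \<le> (1 - \<alpha>) * ((1 / real K) * (\<Sum>j<K. D u (anchor z0 z s j)))"
      using \<alpha>_range anchor_dom by (intro mult_left_mono mean_anchor_le[OF wbar_anchor K_pos wbar_subdiff]) auto
    moreover have "\<tau> * (blinfun_apply (F (w s)) (u - ?zh) + gR u - gR ?zh) \<le> \<tau> * (blinfun_apply (F u - F (w s)) (?zh - u))"
      using \<tau>_pos vi by (simp add: blinfun.diff_left blinfun.diff_right)
    moreover have "\<tau> * blinfun_apply (F u - F (w s)) (?zh - u) \<le> \<tau>\<^sup>2 * L\<^sup>2 * (norm (u - w s))\<^sup>2 + (norm (?zh - u))\<^sup>2 / 4"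
    proof -
      have "\<tau> * blinfun_apply (F u - F (w s)) (?zh - u) \<le> \<tau> * (L * norm (u - w s) * norm (?zh - u))"
        using pair[of "F u - F (w s)"] lip \<tau>_pos by (intro mult_left_mono order_trans[OF pair] mult_right_mono) auto
      also have "\<dots> \<le> \<tau>\<^sup>2 * L\<^sup>2 * (norm (u - w s))\<^sup>2 + (norm (?zh - u))\<^sup>2 / 4"
        using sum_squares_bound[of "\<tau> * L * norm (u - w s)" "norm (?zh - u) / 2"]
        by (simp add: power_mult_distrib power_divide mult.assoc)
      finally show ?thesis .
    qed
    ultimately show ?thesis
      using 1 unfolding right_diff_distrib norm_minus_commute[of u ?zh] by linarith
  qed
  show "D u (z s (Suc k)) \<le> \<alpha> * D u (z s k) + (1 - \<alpha>) * ((1 / real K) * (\<Sum>j<K. D u (anchor z0 z s j)))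
      + (\<tau> * (norm (noise F Fo (\<xi> s k) ?zh (w s)) * norm (?zh - u))
        + \<tau>\<^sup>2 / 2 * (norm (Fo (\<xi> s k) ?zh - Fo (\<xi> s k) (w s)))\<^sup>2)"
  proof -
    have "0 \<le> \<tau> * (blinfun_apply (F ?zh) (?zh - u) + gR ?zh - gR u)"
    proof -
      have "0 \<le> blinfun_apply (F ?zh - F u) (?zh - u)"
        using mono zh_dom[OF k] u unfolding monotone_operator_on_def by blast
      then show ?thesis using vi \<tau>_pos by (simp add: blinfun.diff_left)
    qed
    moreover have "\<tau> * blinfun_apply (noise F Fo (\<xi> s k) ?zh (w s)) (?zh - u)
        \<le> \<tau> * (norm (noise F Fo (\<xi> s k) ?zh (w s)) * norm (?zh - u))"
      using \<tau>_pos pair by simp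
    moreover have "0 \<le> (1 - \<alpha>) / 2 * (norm (?zh - w s))\<^sup>2"
      using \<alpha>_range by simp
    ultimately show ?thesis using inner_step_bound[OF k u, of s] by linarith
  qed
qed

end

section \<open>Moments along the random process\<close>

text \<open>Integrability of the positive part for functions that are not known to be measurable. The distance
  \<open>D u (z s k \<omega>)\<close> is one, as the gradient of \<open>h\<close> need not be a measurable function.\<close>

definition dominated :: "'w measure \<Rightarrow> ('w \<Rightarrow> real) \<Rightarrow> bool" where
  "dominated M f \<longleftrightarrow> (\<exists>B. integrable M B \<and> (\<forall>\<omega>\<in>space M. f \<omega> \<le> B \<omega>))"

lemma dominatedI: "integrable M B \<Longrightarrow> (\<And>\<omega>. \<omega> \<in> space M \<Longrightarrow> f \<omega> \<le> B \<omega>) \<Longrightarrow> dominated M f"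
  unfolding dominated_def by blast

lemma dominated_mono: "dominated M u \<Longrightarrow> (\<And>\<omega>. \<omega> \<in> space M \<Longrightarrow> f \<omega> \<le> u \<omega>) \<Longrightarrow> dominated M f"
  unfolding dominated_def by (meson order_trans)

lemma dominated_add:
  assumes "dominated M f" "dominated M u"
  shows "dominated M (\<lambda>\<omega>. f \<omega> + u \<omega>)"
proof -
  obtain A B where "integrable M A" "\<forall>\<omega>\<in>space M. f \<omega> \<le> A \<omega>" "integrable M B" "\<forall>\<omega>\<in>space M. u \<omega> \<le> B \<omega>"
    using assms unfolding dominated_def by blast
  then show ?thesis by (intro dominatedI[of M "\<lambda>\<omega>. A \<omega> + B \<omega>"]) (auto intro: add_mono)
qed

lemma dominated_scale:
  assumes "dominated M f" "0 \<le> c"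
  shows "dominated M (\<lambda>\<omega>. c * f \<omega>)"
proof -
  obtain A where "integrable M A" "\<forall>\<omega>\<in>space M. f \<omega> \<le> A \<omega>"
    using assms unfolding dominated_def by blast
  then show ?thesis by (intro dominatedI[of M "\<lambda>\<omega>. c * A \<omega>"]) (auto intro: mult_left_mono assms)
qed

lemma dominated_sum:
  assumes "\<And>i. i < (n :: nat) \<Longrightarrow> dominated M (f i)"
  shows "dominated M (\<lambda>\<omega>. \<Sum>i<n. f i \<omega>)"
  using assms
proof (induction n)
  case 0
  show ?case by (rule dominatedI[of M "\<lambda>_. 0"]) auto
next
  case (Suc n)
  then show ?case using dominated_add[of M "\<lambda>\<omega>. \<Sum>i<n. f i \<omega>" "f n"] by simp
qed

lemma dominated_integrable:
  assumes "dominated M f" "f \<in> borel_measurable M" "\<And>\<omega>. 0 \<le> f \<omega>"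
  shows "integrable M f"
proof -
  obtain B where B: "integrable M B" "\<forall>\<omega>\<in>space M. f \<omega> \<le> B \<omega>"
    using assms(1) unfolding dominated_def by blast
  then show ?thesis
    using assms(2,3) by (intro Bochner_Integration.integrable_bound[OF B(1) assms(2)]) (auto intro!: AE_I2 simp: order_trans[OF _ abs_ge_self])
qed

lemma square_sum_le: "(a + b)\<^sup>2 \<le> 2 * a\<^sup>2 + 2 * (b::real)\<^sup>2"
  using sum_squares_bound[of a b] by (simp add: power2_sum)

locale mp_process = prox_geometry g h
  for g h :: "'a::real_normed_vector \<Rightarrow> ereal" +
  fixes F :: "'a \<Rightarrow> ('a \<Rightarrow>\<^sub>L real)" and Fo :: "'x \<Rightarrow> 'a \<Rightarrow> ('a \<Rightarrow>\<^sub>L real)"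
    and \<Xi> :: "'x measure" and Q :: "'a \<Rightarrow> 'a \<Rightarrow> 'x measure"
    and M :: "'w measure" and G :: "nat \<Rightarrow> 'w measure" and \<xi> :: "nat \<Rightarrow> nat \<Rightarrow> 'w \<Rightarrow> 'x"
    and z zh :: "nat \<Rightarrow> nat \<Rightarrow> 'w \<Rightarrow> 'a" and w wbar :: "nat \<Rightarrow> 'w \<Rightarrow> 'a"
    and z0 :: 'a and L \<alpha> \<tau> :: real and K :: nat
  assumes F_mono: "monotone_operator_on (eff_dom g) F"
    and sol: "vi_solutions F g \<noteq> {}"
    and L_pos: "L > 0"
    and F_lip: "variable_lipschitz_oracle L (eff_dom g) \<Xi> Q Fo F"
    and \<alpha>_range: "0 \<le> \<alpha>" "\<alpha> \<le> 1" and \<tau>_pos: "\<tau> > 0" and K_pos: "K > 0"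
    and z0_dom: "z0 \<in> eff_dom g" and z0_subdiff: "z0 \<in> dom_subdiff h"
    and process: "mirror_prox_vr_process M G \<Xi> Q g h F Fo \<alpha> \<tau> K z0 \<xi> z zh w wbar"
begin

lemma prob_M: "prob_space M"
  and filtration: "filtration (space M) G"
  and sub: "subalgebra M (G n)"
  and z_meas: "k \<le> K \<Longrightarrow> strongly_measurable (G (s * K + k)) (z s k)"
  using process unfolding mirror_prox_vr_process_def by blast+

sublocale prob_space M by (rule prob_M)

lemma run:
  assumes "\<omega> \<in> space M"
  shows "mp_run g h F Fo \<alpha> \<tau> K z0 (\<lambda>s k. \<xi> s k \<omega>) (\<lambda>s k. z s k \<omega>)
    (\<lambda>s k. zh s k \<omega>) (\<lambda>s. w s \<omega>) (\<lambda>s. wbar s \<omega>)"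
proof -
  have "mirror_prox_vr_run g h F Fo \<alpha> \<tau> K z0 (\<lambda>s k. \<xi> s k \<omega>) (\<lambda>s k. z s k \<omega>)
      (\<lambda>s k. zh s k \<omega>) (\<lambda>s. w s \<omega>) (\<lambda>s. wbar s \<omega>)"
    using process assms unfolding mirror_prox_vr_process_def by blast
  then show ?thesis
    by unfold_locales (use \<tau>_pos \<alpha>_range K_pos z0_dom in simp_all)
qed

lemma space_G: "space (G n) = space M"
  using sub by (simp add: subalgebra_def)

lemma measurable_G_mono:
  assumes "m \<le> n" "f \<in> G m \<rightarrow>\<^sub>M N"
  shows "f \<in> G n \<rightarrow>\<^sub>M N"
proof (rule measurable_from_subalg[OF _ assms(2)])
  show "subalgebra (G n) (G m)"
    unfolding subalgebra_def space_G
    using filtration.sets_F_mono[OF filtration assms(1)] by (intro conjI refl)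
qed

lemma ident_G_mono: "m \<le> n \<Longrightarrow> (\<lambda>\<omega>. \<omega>) \<in> G n \<rightarrow>\<^sub>M G m"
  by (rule measurable_G_mono[OF _ measurable_ident_sets[OF refl]])

lemma measurable_G_M: "f \<in> G n \<rightarrow>\<^sub>M N \<Longrightarrow> f \<in> M \<rightarrow>\<^sub>M N"
  by (rule measurable_from_subalg[OF sub])

text \<open>The double index \<open>(s, k)\<close> is flattened to \<open>n = s K + k\<close>, which is the index of the filtration.\<close>

definition "half n = zh (n div K) (n mod K)"
definition "snapshot n = w (n div K)"
definition "sample n = \<xi> (n div K) (n mod K)"
definition "spread n \<omega> = norm (half n \<omega> - snapshot n \<omega>)"
definition "variation n \<omega> = norm (Fo (sample n \<omega>) (half n \<omega>) - Fo (sample n \<omega>) (snapshot n \<omega>))"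
definition "err n \<omega> = noise F Fo (sample n \<omega>) (half n \<omega>) (snapshot n \<omega>)"

lemma
  shows half_meas: "strongly_measurable (G n) (half n)"
    and sample_meas: "sample n \<in> G (Suc n) \<rightarrow>\<^sub>M \<Xi>"
    and sampled: "sampled_from M (G n) \<Xi> (sample n) (\<lambda>\<omega>. Q (half n \<omega>) (snapshot n \<omega>))"
    and half_pair_meas: "(\<lambda>(\<omega>, x). blinfun_apply (Fo x (half n \<omega>)) d) \<in> borel_measurable (G n \<Otimes>\<^sub>M \<Xi>)"
    and snapshot_pair_meas: "(\<lambda>(\<omega>, x). blinfun_apply (Fo x (snapshot n \<omega>)) d) \<in> borel_measurable (G n \<Otimes>\<^sub>M \<Xi>)"
    and variation_pair_meas: "(\<lambda>(\<omega>, x). norm (Fo x (half n \<omega>) - Fo x (snapshot n \<omega>))) \<in> borel_measurable (G n \<Otimes>\<^sub>M \<Xi>)"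
proof -
  have k: "n mod K < K" and n: "n div K * K + n mod K = n"
    using K_pos by simp_all
  have "let s = n div K; k = n mod K in
      strongly_measurable (G (s * K + k)) (zh s k) \<and>
        \<xi> s k \<in> G (Suc (s * K + k)) \<rightarrow>\<^sub>M \<Xi> \<and>
        sampled_from M (G (s * K + k)) \<Xi> (\<xi> s k) (\<lambda>\<omega>. Q (zh s k \<omega>) (w s \<omega>)) \<and>
        (\<forall>d. (\<lambda>(\<omega>, x). blinfun_apply (Fo x (zh s k \<omega>)) d)
               \<in> borel_measurable (G (s * K + k) \<Otimes>\<^sub>M \<Xi>)) \<and>
        (\<forall>d. (\<lambda>(\<omega>, x). blinfun_apply (Fo x (w s \<omega>)) d)
               \<in> borel_measurable (G (s * K + k) \<Otimes>\<^sub>M \<Xi>)) \<and>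
        (\<lambda>(\<omega>, x). norm (Fo x (zh s k \<omega>) - Fo x (w s \<omega>)))
          \<in> borel_measurable (G (s * K + k) \<Otimes>\<^sub>M \<Xi>)"
    using process k unfolding mirror_prox_vr_process_def Let_def by blast
  then show "strongly_measurable (G n) (half n)" "sample n \<in> G (Suc n) \<rightarrow>\<^sub>M \<Xi>"
    "sampled_from M (G n) \<Xi> (sample n) (\<lambda>\<omega>. Q (half n \<omega>) (snapshot n \<omega>))"
    "(\<lambda>(\<omega>, x). blinfun_apply (Fo x (half n \<omega>)) d) \<in> borel_measurable (G n \<Otimes>\<^sub>M \<Xi>)"
    "(\<lambda>(\<omega>, x). blinfun_apply (Fo x (snapshot n \<omega>)) d) \<in> borel_measurable (G n \<Otimes>\<^sub>M \<Xi>)"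
    "(\<lambda>(\<omega>, x). norm (Fo x (half n \<omega>) - Fo x (snapshot n \<omega>))) \<in> borel_measurable (G n \<Otimes>\<^sub>M \<Xi>)"
    unfolding Let_def n half_def snapshot_def sample_def by blast+
qed

lemma half_dom: "\<omega> \<in> space M \<Longrightarrow> half n \<omega> \<in> eff_dom g"
  unfolding half_def using K_pos by (intro mp_run.zh_dom[OF run]) auto

lemma snapshot_dom: "\<omega> \<in> space M \<Longrightarrow> snapshot n \<omega> \<in> eff_dom g"
  unfolding snapshot_def by (rule mp_run.w_dom[OF run])

text \<open>The sum is built up by adding one strongly measurable iterate at a time, as in
  \<open>strongly_measurable_add\<close>.\<close>

lemma w_meas: "w s \<in> borel_measurable (G (s * K))"
proof (cases s)
  case 0
  then have "w s \<in> borel_measurable (G (s * K)) \<longleftrightarrow> (\<lambda>_. z0) \<in> borel_measurable (G (s * K))"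
    by (intro measurable_cong) (simp add: space_G mp_run.w_start(1)[OF run])
  then show ?thesis by simp
next
  case (Suc t)
  have "(\<lambda>\<omega>. \<Sum>j<m. z t (Suc j) \<omega>) \<in> borel_measurable (G (s * K))" if "m \<le> K" for m
    using that
  proof (induction m)
    case (Suc m)
    have z: "strongly_measurable (G (t * K + Suc m)) (z t (Suc m))"
      using z_meas[of "Suc m" t] Suc.prems by simp
    have id: "(\<lambda>\<omega>. \<omega>) \<in> G (s * K) \<rightarrow>\<^sub>M G (t * K + Suc m)"
      using Suc.prems \<open>s = Suc t\<close> by (intro ident_G_mono) simp
    show ?case
      using strongly_measurable_add[OF strongly_measurable_compose[OF z id] Suc.IH] Suc.prems
      by (simp add: add.commute)
  qed simp
  from this[of K] have "(\<lambda>\<omega>. (1 / real K) *\<^sub>R (\<Sum>j<K. z t (Suc j) \<omega>)) \<in> borel_measurable (G (s * K))"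
    by (rule measurable_compose[OF _ borel_measurable_continuous_onI[of "\<lambda>x. (1 / real K) *\<^sub>R x"]])
      (simp, intro continuous_intros)
  moreover have "w s \<in> borel_measurable (G (s * K))
      \<longleftrightarrow> (\<lambda>\<omega>. (1 / real K) *\<^sub>R (\<Sum>j<K. z t (Suc j) \<omega>)) \<in> borel_measurable (G (s * K))"
    by (intro measurable_cong)
      (simp only: Suc space_G mp_run.w_Suc[OF run] sum_shift_one)
  ultimately show ?thesis by simp
qed

lemma snapshot_meas: "snapshot n \<in> borel_measurable (G n)"
  unfolding snapshot_def by (rule measurable_G_mono[OF _ w_meas]) simp

lemma spread_meas: "spread n \<in> borel_measurable (G n)"
  unfolding spread_def[abs_def] by (rule strongly_measurable_norm_diff[OF half_meas snapshot_meas])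

lemma history_sample_meas: "(\<lambda>\<omega>. (\<omega>, sample n \<omega>)) \<in> G (Suc n) \<rightarrow>\<^sub>M G n \<Otimes>\<^sub>M \<Xi>"
  by (intro measurable_Pair sample_meas ident_G_mono) simp

lemma variation_meas: "variation n \<in> borel_measurable M"
  using measurable_compose[OF history_sample_meas[of n] variation_pair_meas]
  unfolding variation_def[abs_def] by (intro measurable_G_M) simp

lemma F_lipschitz: "u \<in> eff_dom g \<Longrightarrow> v \<in> eff_dom g \<Longrightarrow> norm (F u - F v) \<le> L * norm (u - v)"
  by (rule mean_operator_lipschitz[OF F_lip L_pos])

text \<open>A Lipschitz map is continuous on the domain of \<open>g\<close>, and continuity on an arbitrary subset is enough
  for measurability with respect to the trace of the Borel sets.\<close>

lemma F_meas:
  assumes u: "u \<in> borel_measurable N" "\<And>\<omega>. \<omega> \<in> space N \<Longrightarrow> u \<omega> \<in> eff_dom g"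
  shows "(\<lambda>\<omega>. blinfun_apply (F (u \<omega>)) d) \<in> borel_measurable N"
proof -
  have "L-lipschitz_on (eff_dom g) F"
    using F_lipschitz L_pos by (intro lipschitz_onI) (auto simp: dist_norm)
  then have "continuous_on (eff_dom g) (\<lambda>x. blinfun_apply (F x) d)"
    by (intro continuous_intros) (rule lipschitz_on_continuous_on)
  then have "(\<lambda>x. blinfun_apply (F x) d) \<in> borel_measurable (restrict_space borel (eff_dom g))"
    by (rule borel_measurable_continuous_on_restrict)
  moreover have "u \<in> N \<rightarrow>\<^sub>M restrict_space borel (eff_dom g)"
    using u by (intro measurable_restrict_space2) auto
  ultimately show ?thesis by (rule measurable_compose[rotated])
qed

lemma err_pair_meas:
  "(\<lambda>(\<omega>, x). blinfun_apply (noise F Fo x (half n \<omega>) (snapshot n \<omega>)) d) \<in> borel_measurable (G n \<Otimes>\<^sub>M \<Xi>)"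
proof -
  have "half n \<in> borel_measurable (G n)"
    using half_meas by (simp add: strongly_measurable_def)
  then have "(\<lambda>\<omega>. blinfun_apply (F (half n \<omega>)) d) \<in> borel_measurable (G n)"
    "(\<lambda>\<omega>. blinfun_apply (F (snapshot n \<omega>)) d) \<in> borel_measurable (G n)"
    using half_dom snapshot_dom snapshot_meas by (auto intro!: F_meas simp: space_G)
  then have "(\<lambda>(\<omega>, x). blinfun_apply (F (half n \<omega>)) d) \<in> borel_measurable (G n \<Otimes>\<^sub>M \<Xi>)"
    "(\<lambda>(\<omega>, x). blinfun_apply (F (snapshot n \<omega>)) d) \<in> borel_measurable (G n \<Otimes>\<^sub>M \<Xi>)"
    unfolding case_prod_beta by (auto intro: measurable_compose[OF measurable_fst])
  then show ?thesis
    using half_pair_meas[of n d] snapshot_pair_meas[of n d]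
    unfolding noise_def blinfun.diff_left case_prod_beta by (intro borel_measurable_diff)
qed

lemma err_meas: "(\<lambda>\<omega>. blinfun_apply (err n \<omega>) d) \<in> borel_measurable (G (Suc n))"
  using measurable_compose[OF history_sample_meas[of n] err_pair_meas[of n d]]
  unfolding err_def by simp

lemma norm_err_le: "\<omega> \<in> space M \<Longrightarrow> norm (err n \<omega>) \<le> variation n \<omega> + L * spread n \<omega>"
  using F_lipschitz[OF half_dom[of \<omega> n] snapshot_dom[of \<omega> n]]
    norm_triangle_ineq4[of "F (half n \<omega>) - F (snapshot n \<omega>)" "Fo (sample n \<omega>) (half n \<omega>) - Fo (sample n \<omega>) (snapshot n \<omega>)"]
  unfolding err_def noise_def variation_def spread_def by linarith

lemma norm_err_square_le: "\<omega> \<in> space M \<Longrightarrow> (norm (err n \<omega>))\<^sup>2 \<le> 2 * (variation n \<omega>)\<^sup>2 + 2 * L\<^sup>2 * (spread n \<omega>)\<^sup>2"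
  using power_mono[OF norm_err_le[of \<omega> n] norm_ge_zero, of 2] square_sum_le[of "variation n \<omega>" "L * spread n \<omega>"]
  by (simp add: power_mult_distrib)

text \<open>Integrate the mean-square Lipschitz bound for the kernel at the current pair of points over
  the past.\<close>

lemma fresh_variation:
  assumes "integrable M (\<lambda>\<omega>. (spread n \<omega>)\<^sup>2)"
  shows "integrable M (\<lambda>\<omega>. (variation n \<omega>)\<^sup>2)"
    and "expectation (\<lambda>\<omega>. (variation n \<omega>)\<^sup>2) \<le> L\<^sup>2 * expectation (\<lambda>\<omega>. (spread n \<omega>)\<^sup>2)"
proof -
  let ?f = "\<lambda>(\<omega>, x). ennreal ((norm (Fo x (half n \<omega>) - Fo x (snapshot n \<omega>)))\<^sup>2)"
  have f: "?f \<in> borel_measurable (G n \<Otimes>\<^sub>M \<Xi>)"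
    using variation_pair_meas[of n] unfolding case_prod_beta by measurable
  have "(\<integral>\<^sup>+\<omega>. ennreal ((variation n \<omega>)\<^sup>2) \<partial>M)
      = (\<integral>\<^sup>+\<omega>. (\<integral>\<^sup>+x. ?f (\<omega>, x) \<partial>Q (half n \<omega>) (snapshot n \<omega>)) \<partial>M)"
    using nn_integral_sampled_from[OF sampled sub prob_M f] by (simp add: variation_def)
  also have "\<dots> \<le> (\<integral>\<^sup>+\<omega>. ennreal (L\<^sup>2 * (spread n \<omega>)\<^sup>2) \<partial>M)"
  proof (rule nn_integral_mono)
    fix \<omega> assume \<omega>: "\<omega> \<in> space M"
    let ?q = "Q (half n \<omega>) (snapshot n \<omega>)" and ?d = "\<lambda>x. (norm (Fo x (half n \<omega>) - Fo x (snapshot n \<omega>)))\<^sup>2"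
    have "integrable ?q ?d" "(\<integral>x. ?d x \<partial>?q) \<le> L\<^sup>2 * (spread n \<omega>)\<^sup>2"
      using F_lip half_dom[OF \<omega>] snapshot_dom[OF \<omega>] unfolding variable_lipschitz_oracle_def spread_def by blast+
    then show "(\<integral>\<^sup>+x. ?f (\<omega>, x) \<partial>?q) \<le> ennreal (L\<^sup>2 * (spread n \<omega>)\<^sup>2)"
      by (simp add: nn_integral_eq_integral ennreal_leI)
  qed
  also have "\<dots> = ennreal (L\<^sup>2 * expectation (\<lambda>\<omega>. (spread n \<omega>)\<^sup>2))"
    using assms by (subst nn_integral_eq_integral) auto
  finally have le: "(\<integral>\<^sup>+\<omega>. ennreal ((variation n \<omega>)\<^sup>2) \<partial>M) \<le> ennreal (L\<^sup>2 * expectation (\<lambda>\<omega>. (spread n \<omega>)\<^sup>2))" .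
  show int: "integrable M (\<lambda>\<omega>. (variation n \<omega>)\<^sup>2)"
    using variation_meas[of n] le by (intro integrableI_bounded) (auto simp: le_less_trans)
  show "expectation (\<lambda>\<omega>. (variation n \<omega>)\<^sup>2) \<le> L\<^sup>2 * expectation (\<lambda>\<omega>. (spread n \<omega>)\<^sup>2)"
    using le nn_integral_eq_integral[OF int] by (simp add: ennreal_le_iff)
qed

text \<open>Given the past, \<open>d - c\<close> is a fixed vector. Under the distribution that belongs to the half step and
  the snapshot, the sampled operator has mean \<open>F\<close> at both points, so the pairing has mean zero.\<close>

lemma expectation_err:
  assumes d: "strongly_measurable (G n) d" "integrable M (\<lambda>\<omega>. (norm (d \<omega> - c))\<^sup>2)"
    and spread: "integrable M (\<lambda>\<omega>. (spread n \<omega>)\<^sup>2)"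
  shows "integrable M (\<lambda>\<omega>. blinfun_apply (err n \<omega>) (d \<omega> - c))"
    and "expectation (\<lambda>\<omega>. blinfun_apply (err n \<omega>) (d \<omega> - c)) = 0"
proof -
  let ?f = "\<lambda>p. blinfun_apply (noise F Fo (snd p) (half n (fst p)) (snapshot n (fst p))) (d (fst p) - c)"
  have Y: "(\<lambda>p. blinfun_apply (noise F Fo (snd p) (half n (fst p)) (snapshot n (fst p))) e) \<in> borel_measurable (G n \<Otimes>\<^sub>M \<Xi>)" for e
    using err_pair_meas[of n e] by (simp add: case_prod_beta)
  have "(\<lambda>p. blinfun_apply (noise F Fo (snd p) (half n (fst p)) (snapshot n (fst p))) (d (fst p))) \<in> borel_measurable (G n \<Otimes>\<^sub>M \<Xi>)"
    by (rule strongly_measurable_pairing[OF strongly_measurable_compose[OF d(1) measurable_fst] Y])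
  then have f: "?f \<in> borel_measurable (G n \<Otimes>\<^sub>M \<Xi>)"
    unfolding blinfun.diff_right by (rule borel_measurable_diff[OF _ Y])
  have eq: "?f (\<omega>, sample n \<omega>) = blinfun_apply (err n \<omega>) (d \<omega> - c)" for \<omega>
    by (simp add: err_def)
  have meas: "(\<lambda>\<omega>. blinfun_apply (err n \<omega>) (d \<omega> - c)) \<in> borel_measurable M"
    using measurable_compose[OF history_sample_meas f] unfolding eq by (rule measurable_G_M)
  have bound: "\<bar>blinfun_apply (err n \<omega>) (d \<omega> - c)\<bar>
      \<le> 2 * (variation n \<omega>)\<^sup>2 + 2 * L\<^sup>2 * (spread n \<omega>)\<^sup>2 + (norm (d \<omega> - c))\<^sup>2" if "\<omega> \<in> space M" for \<omega>
  proof -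
    have "\<bar>blinfun_apply (err n \<omega>) (d \<omega> - c)\<bar> \<le> norm (err n \<omega>) * norm (d \<omega> - c)"
      using norm_blinfun[of "err n \<omega>" "d \<omega> - c"] by simp
    also have "\<dots> \<le> (norm (err n \<omega>))\<^sup>2 + (norm (d \<omega> - c))\<^sup>2"
      using sum_squares_bound[of "norm (err n \<omega>)" "norm (d \<omega> - c)"]
        mult_nonneg_nonneg[OF norm_ge_zero[of "err n \<omega>"] norm_ge_zero[of "d \<omega> - c"]] by linarith
    finally show ?thesis using norm_err_square_le[OF that, of n] by linarith
  qed
  have dom: "integrable M (\<lambda>\<omega>. 2 * (variation n \<omega>)\<^sup>2 + 2 * L\<^sup>2 * (spread n \<omega>)\<^sup>2 + (norm (d \<omega> - c))\<^sup>2)"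
    using fresh_variation(1)[OF spread] spread d(2)
    by (intro Bochner_Integration.integrable_add integrable_mult_right)
  show int: "integrable M (\<lambda>\<omega>. blinfun_apply (err n \<omega>) (d \<omega> - c))"
  proof (rule Bochner_Integration.integrable_bound[OF dom meas], rule AE_I2)
    fix \<omega> assume "\<omega> \<in> space M"
    from bound[OF this] show "norm (blinfun_apply (err n \<omega>) (d \<omega> - c))
      \<le> norm (2 * (variation n \<omega>)\<^sup>2 + 2 * L\<^sup>2 * (spread n \<omega>)\<^sup>2 + (norm (d \<omega> - c))\<^sup>2)"
      unfolding real_norm_def by linarith
  qed
  have centred: "has_bochner_integral (Q (half n \<omega>) (snapshot n \<omega>)) (\<lambda>x. ?f (\<omega>, x)) 0"
    if \<omega>: "\<omega> \<in> space M" for \<omega>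
  proof -
    let ?q = "Q (half n \<omega>) (snapshot n \<omega>)" and ?e = "d \<omega> - c"
    have q: "prob_space ?q"
      and mean: "\<And>u. u \<in> eff_dom g \<Longrightarrow> has_bochner_integral ?q (\<lambda>x. blinfun_apply (Fo x u) ?e) (blinfun_apply (F u) ?e)"
      using F_lip half_dom[OF \<omega>, of n] snapshot_dom[OF \<omega>, of n]
      unfolding variable_lipschitz_oracle_def has_dual_expectation_def space_prob_algebra by blast+
    interpret q: prob_space ?q by (rule q)
    let ?m = "blinfun_apply (F (half n \<omega>)) ?e - blinfun_apply (F (snapshot n \<omega>)) ?e"
    have "has_bochner_integral ?q (\<lambda>x. ?m - (blinfun_apply (Fo x (half n \<omega>)) ?e - blinfun_apply (Fo x (snapshot n \<omega>)) ?e)) (?m - ?m)"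
      using half_dom[OF \<omega>] snapshot_dom[OF \<omega>]
      by (intro has_bochner_integral_diff mean) (simp_all add: has_bochner_integral_iff q.prob_space)
    then show ?thesis by (simp add: noise_def blinfun.diff_left)
  qed
  have "expectation (\<lambda>\<omega>. ?f (\<omega>, sample n \<omega>)) = 0"
    by (rule expectation_centred_sample[OF sampled sub prob_M f centred]) (simp_all only: eq int)
  then show "expectation (\<lambda>\<omega>. blinfun_apply (err n \<omega>) (d \<omega> - c)) = 0"
    unfolding eq .
qed

abbreviation "anchors s j \<omega> \<equiv> anchor z0 (\<lambda>s k. z s k \<omega>) s j"

text \<open>The three bounds of \<open>step_at_solution\<close> are used in turn: they control the snapshot and the half step,
  hence the second moment of the fresh sample, hence the next iterate.\<close>

lemma integrability_step:
  assumes u: "u \<in> vi_solutions F g" and n: "n = s * K + k" and k: "k < K"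
    and z: "dominated M (\<lambda>\<omega>. D u (z s k \<omega>))"
    and a: "\<And>j. j < K \<Longrightarrow> dominated M (\<lambda>\<omega>. D u (anchors s j \<omega>))"
  shows "integrable M (\<lambda>\<omega>. (norm (half n \<omega> - u))\<^sup>2)"
    and "integrable M (\<lambda>\<omega>. (spread n \<omega>)\<^sup>2)"
    and "dominated M (\<lambda>\<omega>. D u (z s (Suc k) \<omega>))"
proof -
  have idx: "half n = zh s k" "snapshot n = w s" "sample n = \<xi> s k"
    using k by (simp_all add: n half_def snapshot_def sample_def)
  have ug: "u \<in> eff_dom g" using u by (simp add: vi_solutions_def)
  let ?A = "\<lambda>\<omega>. (1 / real K) * (\<Sum>j<K. D u (anchors s j \<omega>))"
  have A: "dominated M ?A"
    using a by (intro dominated_scale dominated_sum) auto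
  have lip: "norm (F u - F (snapshot n \<omega>)) \<le> L * norm (u - snapshot n \<omega>)" if "\<omega> \<in> space M" for \<omega>
    by (rule F_lipschitz[OF ug snapshot_dom[OF that]])
  note at_sol = mp_run.step_at_solution[OF run F_mono u k lip[unfolded idx], folded idx]
  have snapM: "snapshot n \<in> borel_measurable M"
    by (rule measurable_G_M[OF snapshot_meas])
  have "(\<lambda>\<omega>. norm (u - snapshot n \<omega>)) \<in> borel_measurable M"
    by (rule measurable_compose[OF snapM]) (intro borel_measurable_continuous_onI continuous_intros)
  then have wmeas: "(\<lambda>\<omega>. (norm (u - snapshot n \<omega>))\<^sup>2) \<in> borel_measurable M" by simp
  have "dominated M (\<lambda>\<omega>. (norm (u - snapshot n \<omega>))\<^sup>2)"
  proof (rule dominated_mono[OF dominated_scale[OF A, of 2]])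
    fix \<omega> assume \<omega>: "\<omega> \<in> space M"
    show "(norm (u - snapshot n \<omega>))\<^sup>2 \<le> 2 * ?A \<omega>"
      using at_sol(3)[OF \<omega> \<omega>] by linarith
  qed simp
  then have wint: "integrable M (\<lambda>\<omega>. (norm (u - snapshot n \<omega>))\<^sup>2)"
    by (rule dominated_integrable[OF _ wmeas]) simp
  have "(\<lambda>\<omega>. norm (half n \<omega> - u)) \<in> borel_measurable M"
    by (rule measurable_G_M, rule strongly_measurable_norm_diff[OF half_meas]) simp
  then have hmeas: "(\<lambda>\<omega>. (norm (half n \<omega> - u))\<^sup>2) \<in> borel_measurable M" by simp
  have rhs: "dominated M (\<lambda>\<omega>. \<alpha> * D u (z s k \<omega>) + (1 - \<alpha>) * ?A \<omega>)"
    using \<alpha>_range by (intro dominated_add dominated_scale z A) auto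
  have wdom: "dominated M (\<lambda>\<omega>. \<tau>\<^sup>2 * L\<^sup>2 * (norm (u - snapshot n \<omega>))\<^sup>2)"
    using wint by (intro dominatedI[of M "\<lambda>\<omega>. \<tau>\<^sup>2 * L\<^sup>2 * (norm (u - snapshot n \<omega>))\<^sup>2"]) auto
  have "dominated M (\<lambda>\<omega>. (norm (half n \<omega> - u))\<^sup>2)"
  proof (rule dominated_mono[OF dominated_scale[OF dominated_add[OF rhs wdom], of 4]])
    fix \<omega> assume \<omega>: "\<omega> \<in> space M"
    show "(norm (half n \<omega> - u))\<^sup>2 \<le> 4 * (\<alpha> * D u (z s k \<omega>) + (1 - \<alpha>) * ?A \<omega>
        + \<tau>\<^sup>2 * L\<^sup>2 * (norm (u - snapshot n \<omega>))\<^sup>2)"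
      using at_sol(2)[OF \<omega> \<omega>] unfolding pos_divide_le_eq[OF zero_less_numeral] by (simp only: mult.commute)
  qed simp
  then show hint: "integrable M (\<lambda>\<omega>. (norm (half n \<omega> - u))\<^sup>2)"
    by (rule dominated_integrable[OF _ hmeas]) simp
  have "(\<lambda>\<omega>. (spread n \<omega>)\<^sup>2) \<in> borel_measurable M"
    using measurable_G_M[OF spread_meas[of n]] by simp
  moreover have "dominated M (\<lambda>\<omega>. (spread n \<omega>)\<^sup>2)"
  proof (rule dominatedI)
    show "integrable M (\<lambda>\<omega>. 2 * (norm (half n \<omega> - u))\<^sup>2 + 2 * (norm (u - snapshot n \<omega>))\<^sup>2)"
      using hint wint by (intro Bochner_Integration.integrable_add integrable_mult_right)
    fix \<omega>
    have "spread n \<omega> \<le> norm (half n \<omega> - u) + norm (u - snapshot n \<omega>)"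
      unfolding spread_def using norm_triangle_ineq[of "half n \<omega> - u" "u - snapshot n \<omega>"] by simp
    then have "(spread n \<omega>)\<^sup>2 \<le> (norm (half n \<omega> - u) + norm (u - snapshot n \<omega>))\<^sup>2"
      by (rule power_mono) (simp add: spread_def)
    then show "(spread n \<omega>)\<^sup>2 \<le> 2 * (norm (half n \<omega> - u))\<^sup>2 + 2 * (norm (u - snapshot n \<omega>))\<^sup>2"
      using square_sum_le by (rule order_trans)
  qed
  ultimately show sint: "integrable M (\<lambda>\<omega>. (spread n \<omega>)\<^sup>2)"
    by (intro dominated_integrable) simp_all
  note vint = fresh_variation(1)[OF sint]
  show "dominated M (\<lambda>\<omega>. D u (z s (Suc k) \<omega>))"
  proof (rule dominated_mono[OF dominated_add[OF rhs]])
    let ?B = "\<lambda>\<omega>. \<tau> * (2 * (variation n \<omega>)\<^sup>2 + 2 * L\<^sup>2 * (spread n \<omega>)\<^sup>2 + (norm (half n \<omega> - u))\<^sup>2)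
      + \<tau>\<^sup>2 / 2 * (variation n \<omega>)\<^sup>2"
    have "integrable M ?B"
      using vint sint hint by (intro Bochner_Integration.integrable_add integrable_mult_right)
    then show "dominated M ?B" by (rule dominatedI) simp
    fix \<omega> assume \<omega>: "\<omega> \<in> space M"
    have "norm (err n \<omega>) * norm (half n \<omega> - u) \<le> (norm (err n \<omega>))\<^sup>2 + (norm (half n \<omega> - u))\<^sup>2"
      using sum_squares_bound[of "norm (err n \<omega>)" "norm (half n \<omega> - u)"]
        mult_nonneg_nonneg[OF norm_ge_zero[of "err n \<omega>"] norm_ge_zero[of "half n \<omega> - u"]] by linarith
    also have "\<dots> \<le> 2 * (variation n \<omega>)\<^sup>2 + 2 * L\<^sup>2 * (spread n \<omega>)\<^sup>2 + (norm (half n \<omega> - u))\<^sup>2"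
      using norm_err_square_le[OF \<omega>, of n] by linarith
    finally have "\<tau> * (norm (err n \<omega>) * norm (half n \<omega> - u))
        \<le> \<tau> * (2 * (variation n \<omega>)\<^sup>2 + 2 * L\<^sup>2 * (spread n \<omega>)\<^sup>2 + (norm (half n \<omega> - u))\<^sup>2)"
      using \<tau>_pos by simp
    then show "D u (z s (Suc k) \<omega>) \<le> \<alpha> * D u (z s k \<omega>) + (1 - \<alpha>) * ?A \<omega> + ?B \<omega>"
      using at_sol(1)[OF \<omega> \<omega>, folded err_def variation_def] by linarith
  qed
qed

text \<open>Induction over epochs and, within an epoch, over inner steps: if the distances from a solution to
  the current iterate and to the anchors have integrable majorants, so has the distance to the
  next iterate. The base case is the deterministic point \<open>z0\<close>.\<close>

lemma square_integrability:
  shows "integrable M (\<lambda>\<omega>. (norm (half n \<omega> - c))\<^sup>2)" and "integrable M (\<lambda>\<omega>. (spread n \<omega>)\<^sup>2)"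
proof -
  obtain u where u: "u \<in> vi_solutions F g" using sol by blast
  have const: "dominated M (\<lambda>\<omega>. D u (f \<omega>))" if "\<And>\<omega>. \<omega> \<in> space M \<Longrightarrow> f \<omega> = z0" for f
    by (rule dominatedI[of M "\<lambda>_. D u z0"]) (simp_all add: that)
  have inner: "dominated M (\<lambda>\<omega>. D u (z s k \<omega>))"
    if "dominated M (\<lambda>\<omega>. D u (z s 0 \<omega>))" "\<And>j. j < K \<Longrightarrow> dominated M (\<lambda>\<omega>. D u (anchors s j \<omega>))" "k \<le> K" for s k
    using that(3)
  proof (induction k)
    case 0
    show ?case by (rule that(1))
  next
    case (Suc k)
    then show ?case by (intro integrability_step(3)[OF u refl _ _ that(2)]) simp_all
  qed
  have outer: "dominated M (\<lambda>\<omega>. D u (z s 0 \<omega>)) \<and> (\<forall>j<K. dominated M (\<lambda>\<omega>. D u (anchors s j \<omega>)))" for s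
  proof (induction s)
    case 0
    show ?case
      using mp_run.z_start(1)[OF run] by (intro conjI allI impI const) (simp_all add: anchor_def)
  next
    case (Suc s)
    have "dominated M (\<lambda>\<omega>. D u (z (Suc s) 0 \<omega>))"
    proof (rule dominated_mono)
      show "dominated M (\<lambda>\<omega>. D u (z s K \<omega>))"
        using inner[of s K] Suc by simp
      show "D u (z (Suc s) 0 \<omega>) \<le> D u (z s K \<omega>)" if "\<omega> \<in> space M" for \<omega>
        using mp_run.z_start(2)[OF run[OF that], of s] by simp
    qed
    moreover have "dominated M (\<lambda>\<omega>. D u (anchors (Suc s) j \<omega>))" if "j < K" for j
      using inner[of s "Suc j"] Suc that by (simp add: anchor_def)
    ultimately show ?case by blast
  qed
  have n: "n = (n div K) * K + n mod K" "n mod K < K" using K_pos by simp_all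
  have dz: "dominated M (\<lambda>\<omega>. D u (z (n div K) (n mod K) \<omega>))"
    by (rule inner[of "n div K" "n mod K"]) (use outer n(2) in simp_all)
  have da: "\<And>j. j < K \<Longrightarrow> dominated M (\<lambda>\<omega>. D u (anchors (n div K) j \<omega>))"
    using outer[of "n div K"] by simp
  note h = integrability_step(1,2)[OF u n dz da]
  then show "integrable M (\<lambda>\<omega>. (spread n \<omega>)\<^sup>2)" by simp
  have "(\<lambda>\<omega>. norm (half n \<omega> - c)) \<in> borel_measurable M"
    by (rule measurable_G_M, rule strongly_measurable_norm_diff[OF half_meas]) simp
  then have m: "(\<lambda>\<omega>. (norm (half n \<omega> - c))\<^sup>2) \<in> borel_measurable M" by simp
  have "dominated M (\<lambda>\<omega>. (norm (half n \<omega> - c))\<^sup>2)"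
  proof (rule dominatedI)
    show "integrable M (\<lambda>\<omega>. 2 * (norm (half n \<omega> - u))\<^sup>2 + 2 * (norm (u - c))\<^sup>2)"
      using h by simp
    fix \<omega>
    have "norm (half n \<omega> - c) \<le> norm (half n \<omega> - u) + norm (u - c)"
      using norm_triangle_ineq[of "half n \<omega> - u" "u - c"] by simp
    then have "(norm (half n \<omega> - c))\<^sup>2 \<le> (norm (half n \<omega> - u) + norm (u - c))\<^sup>2"
      by (rule power_mono) simp
    then show "(norm (half n \<omega> - c))\<^sup>2 \<le> 2 * (norm (half n \<omega> - u))\<^sup>2 + 2 * (norm (u - c))\<^sup>2"
      using square_sum_le by (rule order_trans)
  qed
  then show "integrable M (\<lambda>\<omega>. (norm (half n \<omega> - c))\<^sup>2)"
    by (rule dominated_integrable[OF _ m]) simp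
qed

end

section \<open>Noise against a comparison point that may depend on it\<close>

text \<open>The gap is a supremum over an uncountable set and may fail to be measurable. Both nonnegative integrals in
  the definition of the expectation are nevertheless monotone.\<close>

lemma ereal_expectation_le:
  assumes B: "integrable M B" and le: "\<And>\<omega>. \<omega> \<in> space M \<Longrightarrow> X \<omega> \<le> ereal (B \<omega>)"
  shows "ereal_expectation M X \<le> ereal (\<integral>\<omega>. B \<omega> \<partial>M)"
proof -
  have fin: "(\<integral>\<^sup>+\<omega>. ennreal (B \<omega>) \<partial>M) < \<infinity>" "(\<integral>\<^sup>+\<omega>. ennreal (- B \<omega>) \<partial>M) < \<infinity>"
    using B by (auto simp: real_integrable_def less_top)
  have "(\<integral>\<^sup>+\<omega>. e2ennreal (X \<omega>) \<partial>M) \<le> (\<integral>\<^sup>+\<omega>. ennreal (B \<omega>) \<partial>M)"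
    using le by (intro nn_integral_mono) (simp flip: e2ennreal_ereal add: e2ennreal_mono)
  moreover have "(\<integral>\<^sup>+\<omega>. ennreal (- B \<omega>) \<partial>M) \<le> (\<integral>\<^sup>+\<omega>. e2ennreal (- X \<omega>) \<partial>M)"
  proof (rule nn_integral_mono)
    fix \<omega> assume "\<omega> \<in> space M"
    then have "ereal (- B \<omega>) \<le> - X \<omega>"
      using le[of \<omega>] by (cases "X \<omega>") auto
    then have "e2ennreal (ereal (- B \<omega>)) \<le> e2ennreal (- X \<omega>)" by (rule e2ennreal_mono)
    then show "ennreal (- B \<omega>) \<le> e2ennreal (- X \<omega>)" by simp
  qed
  ultimately have "ereal_expectation M X
      \<le> enn2ereal (\<integral>\<^sup>+\<omega>. ennreal (B \<omega>) \<partial>M) - enn2ereal (\<integral>\<^sup>+\<omega>. ennreal (- B \<omega>) \<partial>M)"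
    unfolding ereal_expectation_def by (intro ereal_minus_mono) (simp_all add: less_eq_ennreal.rep_eq)
  also have "\<dots> = ereal (\<integral>\<omega>. B \<omega> \<partial>M)"
    using fin by (cases "\<integral>\<^sup>+\<omega>. ennreal (B \<omega>) \<partial>M"; cases "\<integral>\<^sup>+\<omega>. ennreal (- B \<omega>) \<partial>M")
      (auto simp: real_lebesgue_integral_def[OF B] enn2ereal_ennreal)
  finally show ?thesis .
qed

context mp_process
begin

text \<open>Let \<open>A\<close> be a countable midpoint-closed set that contains a dense subset of \<open>C \<inter> eff_dom g\<close>, and let \<open>x n\<close> be the first element,
  in an enumeration of \<open>A\<close>, that maximises \<open>a \<mapsto> \<langle>U\<^sub>n, a - z0\<rangle> - D a z0\<close> up to \<open>\<epsilon>\<close>, where \<open>U\<^sub>n\<close> is the sum of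
  the noise before time \<open>n\<close> scaled by \<open>- \<tau>/c\<close>. Countability makes \<open>x n\<close> measurable with respect to
  the past, and \<open>dual_averaging_regret\<close> bounds \<open>\<langle>U\<^sub>N, u - z0\<rangle>\<close> on the dense subset. The bound extends
  to \<open>C \<inter> eff_dom g\<close> because it is linear in \<open>u\<close> once \<open>D u z0\<close> has been replaced by \<open>R\<close>.\<close>

lemma noise_support_bound:
  assumes C: "compact C" and ne: "C \<inter> eff_dom g \<noteq> {}"
    and R: "\<And>u. u \<in> C \<inter> eff_dom g \<Longrightarrow> D u z0 \<le> R"
    and c: "c > 0" and \<epsilon>: "\<epsilon> > 0"
  shows "\<exists>x r. (\<forall>n. strongly_measurable (G n) (x n)) \<and> (\<forall>n \<omega>. norm (x n \<omega> - z0) \<le> r) \<and>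
    (\<forall>\<omega> N. \<forall>u\<in>C \<inter> eff_dom g. - \<tau> * (\<Sum>j<N. blinfun_apply (err j \<omega>) (u - z0))
      \<le> c * R + (\<Sum>j<N. 2 * c * \<epsilon> - \<tau> * blinfun_apply (err j \<omega>) (x j \<omega> - z0) + \<tau>\<^sup>2 / c * (norm (err j \<omega>))\<^sup>2))"
proof -
  let ?T = "C \<inter> eff_dom g"
  obtain Z where Z: "countable Z" "Z \<subseteq> ?T" "?T \<subseteq> closure Z"
    using countable_dense_subset_of_compact[OF C, of ?T] by blast
  obtain A where A: "countable A" "Z \<subseteq> A" "A \<subseteq> convex hull Z"
    and mid: "\<And>x y. x \<in> A \<Longrightarrow> y \<in> A \<Longrightarrow> (1 - 1 / 2 :: real) *\<^sub>R x + (1 / 2 :: real) *\<^sub>R y \<in> A"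
    using countable_midpoint_closure[OF Z(1)] by blast
  have Ag: "A \<subseteq> eff_dom g"
    using A(3) hull_minimal[of Z "eff_dom g" convex] Z(2) convex_dom_g by blast
  have "Z \<noteq> {}" using Z(3) ne by auto
  then have A_ne: "A \<noteq> {}" using A(2) by blast
  \<comment> \<open>Boundedness makes the objectives bounded above on \<open>A\<close> and the selected points square integrable.\<close>
  obtain r where r: "C \<subseteq> cball z0 r"
    using compact_imp_bounded[OF C] unfolding bounded_any_center[of _ z0] by (auto simp: subset_iff)
  have Ar: "norm (a - z0) \<le> r" if "a \<in> A" for a
  proof -
    have "convex hull Z \<subseteq> cball z0 r"
      using Z(2) r by (intro hull_minimal convex_cball) auto
    then show ?thesis using that A(3) by (auto simp: dist_norm norm_minus_commute)
  qed
  define e where "e = from_nat_into A"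
  have e: "e m \<in> A" for m unfolding e_def by (rule from_nat_into[OF A_ne])
  have e_surj: "\<exists>m. a = e m" if "a \<in> A" for a
    using from_nat_into_surj[OF A(1) that] unfolding e_def by metis
  define v where "v j \<omega> = (- \<tau> / c) *\<^sub>R err j \<omega>" for j \<omega>
  define \<phi> where "\<phi> n \<omega> a = blinfun_apply (\<Sum>j<n. v j \<omega>) (a - z0) - D a z0" for n \<omega> a
  define i where "i n \<omega> = (LEAST m. \<forall>m'. \<phi> n \<omega> (e m') \<le> \<phi> n \<omega> (e m) + \<epsilon>)" for n \<omega>
  define x where "x n \<omega> = e (i n \<omega>)" for n \<omega>
  have v_meas: "(\<lambda>\<omega>. blinfun_apply (v j \<omega>) d) \<in> borel_measurable (G n)" if "j < n" for j n d
  proof -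
    have "(\<lambda>\<omega>. blinfun_apply (err j \<omega>) d) \<in> borel_measurable (G n)"
      using that by (intro measurable_G_mono[OF _ err_meas]) simp
    then show ?thesis by (simp add: v_def blinfun.scaleR_left blinfun.minus_left)
  qed
  have \<phi>_meas: "(\<lambda>\<omega>. \<phi> n \<omega> a) \<in> borel_measurable (G n)" for n a
    unfolding \<phi>_def blinfun.sum_left using v_meas[of _ n]
    by (intro borel_measurable_diff borel_measurable_sum borel_measurable_const) simp
  have pred: "Measurable.pred (G n) (\<lambda>\<omega>. \<phi> n \<omega> (e m') \<le> \<phi> n \<omega> (e m) + \<epsilon>)" for n m m'
    unfolding pred_def by (intro borel_measurable_le borel_measurable_add \<phi>_meas borel_measurable_const)
  have i_meas: "i n \<in> G n \<rightarrow>\<^sub>M count_space UNIV" for n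
    unfolding i_def[abs_def] by (rule measurable_Least) (rule pred_intros_countable(1)[OF pred])
  have x_meas: "strongly_measurable (G n) (x n)" for n
    unfolding x_def[abs_def] by (rule strongly_measurable_countable_range[OF i_meas])
  have maximal: "\<phi> n \<omega> a \<le> \<phi> n \<omega> (x n \<omega>) + \<epsilon>" if a: "a \<in> A" for n \<omega> a
  proof -
    let ?U = "\<Sum>j<n. v j \<omega>"
    have "\<phi> n \<omega> b \<le> norm ?U * r" if "b \<in> A" for b
    proof -
      have "blinfun_apply ?U (b - z0) \<le> norm ?U * norm (b - z0)"
        using norm_blinfun[of ?U "b - z0"] by simp
      also have "\<dots> \<le> norm ?U * r" using Ar[OF that] by (intro mult_left_mono) auto
      finally show ?thesis
        using D_nonneg[OF _ z0_subdiff, of b] that Ag dom_gh by (auto simp: \<phi>_def)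
    qed
    then have bdd: "bdd_above (\<phi> n \<omega> ` A)" by (rule bdd_aboveI2)
    obtain b where b: "b \<in> A" "(SUP a\<in>A. \<phi> n \<omega> a) - \<epsilon> < \<phi> n \<omega> b"
      using less_cSUP_iff[OF A_ne bdd, of "(SUP a\<in>A. \<phi> n \<omega> a) - \<epsilon>"] \<epsilon> by auto
    obtain m where m: "b = e m" using e_surj[OF b(1)] by blast
    have "\<forall>m'. \<phi> n \<omega> (e m') \<le> \<phi> n \<omega> (e m) + \<epsilon>"
    proof
      fix m'
      show "\<phi> n \<omega> (e m') \<le> \<phi> n \<omega> (e m) + \<epsilon>"
        using cSUP_upper[OF e[of m'] bdd] b(2) m by simp
    qed
    then have "\<forall>m'. \<phi> n \<omega> (e m') \<le> \<phi> n \<omega> (e (i n \<omega>)) + \<epsilon>"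
      unfolding i_def by (rule LeastI)
    moreover obtain m' where "a = e m'" using e_surj[OF a] by blast
    ultimately show ?thesis by (simp add: x_def)
  qed
  have regret: "- \<tau> * (\<Sum>j<N. blinfun_apply (err j \<omega>) (u - z0))
      \<le> c * R + (\<Sum>j<N. 2 * c * \<epsilon> - \<tau> * blinfun_apply (err j \<omega>) (x j \<omega> - z0) + \<tau>\<^sup>2 / c * (norm (err j \<omega>))\<^sup>2)"
    if u: "u \<in> ?T" for \<omega> N u
  proof -
    let ?U = "\<Sum>j<N. v j \<omega>"
    let ?S = "\<Sum>j<N. 2 * \<epsilon> + blinfun_apply (v j \<omega>) (x j \<omega> - z0) + (norm (v j \<omega>))\<^sup>2"
    have on_Z: "blinfun_apply ?U (a - z0) \<le> R + ?S" if "a \<in> Z" for a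
    proof -
      have "blinfun_apply ?U (a - z0) - D a z0 \<le> ?S"
      proof (intro dual_averaging_regret[OF Ag mid z0_subdiff, where x = "\<lambda>n. x n \<omega>"])
        show "x n \<omega> \<in> A" for n unfolding x_def by (rule e)
        show "blinfun_apply (\<Sum>j<n. v j \<omega>) (b - z0) - D b z0
            \<le> blinfun_apply (\<Sum>j<n. v j \<omega>) (x n \<omega> - z0) - D (x n \<omega>) z0 + \<epsilon>" if "b \<in> A" for n b
          using maximal[OF that, of n \<omega>] unfolding \<phi>_def .
        show "a \<in> A" using A(2) that by blast
      qed
      moreover have "D a z0 \<le> R" using Z(2) that by (intro R) blast
      ultimately show ?thesis by linarith
    qed
    \<comment> \<open>Extend the bound from the dense subset \<open>Z\<close> to its closure.\<close>
    have "closed {a. blinfun_apply ?U (a - z0) \<le> R + ?S}"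
      by (intro closed_Collect_le continuous_intros)
    then have "closure Z \<subseteq> {a. blinfun_apply ?U (a - z0) \<le> R + ?S}"
      using on_Z by (intro closure_minimal) auto
    then have "blinfun_apply ?U (u - z0) \<le> R + ?S" using u Z(3) by blast
    then have "c * blinfun_apply ?U (u - z0) \<le> c * R + c * ?S"
      using c by (simp flip: distrib_left)
    moreover have "c * blinfun_apply ?U (u - z0) = - \<tau> * (\<Sum>j<N. blinfun_apply (err j \<omega>) (u - z0))"
      using c by (simp add: v_def blinfun.sum_left blinfun.scaleR_left blinfun.minus_left sum_distrib_left)
    moreover have "c * ?S = (\<Sum>j<N. 2 * c * \<epsilon> - \<tau> * blinfun_apply (err j \<omega>) (x j \<omega> - z0) + \<tau>\<^sup>2 / c * (norm (err j \<omega>))\<^sup>2)"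
      using c unfolding sum_distrib_left v_def blinfun.scaleR_left norm_scaleR
      by (intro sum.cong refl) (simp add: power_mult_distrib power_divide power2_eq_square field_simps)
    ultimately show ?thesis by simp
  qed
  have "norm (x n \<omega> - z0) \<le> r" for n \<omega>
    unfolding x_def by (rule Ar[OF e])
  then show ?thesis
    using x_meas regret by (intro exI[of _ x] exI[of _ r]) blast
qed

text \<open>Replaces the random and possibly non-measurable supremum over \<open>u\<close> by an integrable variable \<open>B\<close>. Its
  summands \<open>E n\<close> collect two pairings of mean zero and multiples of \<open>variation\<^sup>2\<close> and \<open>spread\<^sup>2\<close>. The
  value of \<open>c\<close> is the one for which these multiples cancel in expectation.\<close>

lemma gap_majorant:
  assumes C: "compact C" and ne: "C \<inter> eff_dom g \<noteq> {}"
    and R: "\<And>u. u \<in> C \<inter> eff_dom g \<Longrightarrow> D u z0 \<le> R"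
    and S: "S > 0" and \<epsilon>: "\<epsilon> > 0"
    and \<gamma>: "0 < \<gamma>" "\<gamma> < 1" and step_size: "\<tau>\<^sup>2 * L\<^sup>2 = (1 - \<alpha>) * \<gamma>\<^sup>2"
  defines "c \<equiv> 8 * \<gamma>\<^sup>2 / (1 - \<gamma>\<^sup>2)"
    and "zS \<equiv> \<lambda>\<omega>. (1 / (real K * real S)) *\<^sub>R (\<Sum>s<S. \<Sum>k<K. zh s k \<omega>)"
  shows "\<exists>B. integrable M B \<and> expectation B \<le> (\<alpha> + real K * (1 - \<alpha>) + c) * R + real (S * K) * (2 * c * \<epsilon>) \<and>
    (\<forall>\<omega>\<in>space M. \<forall>u\<in>C \<inter> eff_dom g.
      \<tau> * real (S * K) * (blinfun_apply (F u) (zS \<omega> - u) + gR (zS \<omega>) - gR u) \<le> B \<omega>)"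
proof -
  have \<gamma>2: "\<gamma>\<^sup>2 < 1" using \<gamma> by (simp add: power_less_one_iff)
  have c: "c > 0" unfolding c_def using \<gamma> \<gamma>2 by simp
  obtain x r where x: "\<And>n. strongly_measurable (G n) (x n)" and xr: "\<And>n \<omega>. norm (x n \<omega> - z0) \<le> r"
    and noise: "\<And>\<omega> N u. u \<in> C \<inter> eff_dom g \<Longrightarrow> - \<tau> * (\<Sum>j<N. blinfun_apply (err j \<omega>) (u - z0))
      \<le> c * R + (\<Sum>j<N. 2 * c * \<epsilon> - \<tau> * blinfun_apply (err j \<omega>) (x j \<omega> - z0) + \<tau>\<^sup>2 / c * (norm (err j \<omega>))\<^sup>2)"
    using noise_support_bound[OF C ne R c \<epsilon>] by blast
  define E where "E n \<omega> = 2 * c * \<epsilon> + \<tau> * blinfun_apply (err n \<omega>) (half n \<omega> - z0)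
      - \<tau> * blinfun_apply (err n \<omega>) (x n \<omega> - z0)
      + (2 * \<tau>\<^sup>2 / c + \<tau>\<^sup>2 / 2) * (variation n \<omega>)\<^sup>2
      + (2 * (\<tau>\<^sup>2 * L\<^sup>2) / c - (1 - \<alpha>) / 2) * (spread n \<omega>)\<^sup>2" for n \<omega>
  define B where "B \<omega> = (\<alpha> + real K * (1 - \<alpha>) + c) * R + (\<Sum>n<S * K. E n \<omega>)" for \<omega>
  have E: "integrable M (E n)" "expectation (E n) \<le> 2 * c * \<epsilon>" for n
  proof -
    note sq = square_integrability(2)[of n]
    have xint: "integrable M (\<lambda>\<omega>. (norm (x n \<omega> - z0))\<^sup>2)"
    proof (rule integrable_const_bound[of _ "r\<^sup>2"])
      show "AE \<omega> in M. norm ((norm (x n \<omega> - z0))\<^sup>2) \<le> r\<^sup>2"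
        using power_mono[OF xr norm_ge_zero, of n _ 2] by (intro AE_I2) simp
      have "(\<lambda>\<omega>. norm (x n \<omega> - z0)) \<in> borel_measurable M"
        by (rule measurable_G_M, rule strongly_measurable_norm_diff[OF x]) simp
      then show "(\<lambda>\<omega>. (norm (x n \<omega> - z0))\<^sup>2) \<in> borel_measurable M" by simp
    qed
    note mh = expectation_err[OF half_meas square_integrability(1) sq]
    note mx = expectation_err[OF x xint sq]
    note fv = fresh_variation[OF sq]
    have hb: "has_bochner_integral M (\<lambda>\<omega>. blinfun_apply (err n \<omega>) (half n \<omega> - z0)) 0"
      "has_bochner_integral M (\<lambda>\<omega>. blinfun_apply (err n \<omega>) (x n \<omega> - z0)) 0"
      "has_bochner_integral M (\<lambda>\<omega>. (variation n \<omega>)\<^sup>2) (expectation (\<lambda>\<omega>. (variation n \<omega>)\<^sup>2))"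
      "has_bochner_integral M (\<lambda>\<omega>. (spread n \<omega>)\<^sup>2) (expectation (\<lambda>\<omega>. (spread n \<omega>)\<^sup>2))"
      "has_bochner_integral M (\<lambda>\<omega>. 2 * c * \<epsilon>) (2 * c * \<epsilon>)"
      using mh mx fv(1) sq by (simp_all add: has_bochner_integral_iff prob_space)
    have "has_bochner_integral M (\<lambda>\<omega>. E n \<omega>) (2 * c * \<epsilon> + \<tau> * 0 - \<tau> * 0
      + (2 * \<tau>\<^sup>2 / c + \<tau>\<^sup>2 / 2) * expectation (\<lambda>\<omega>. (variation n \<omega>)\<^sup>2)
      + (2 * (\<tau>\<^sup>2 * L\<^sup>2) / c - (1 - \<alpha>) / 2) * expectation (\<lambda>\<omega>. (spread n \<omega>)\<^sup>2))"
      unfolding E_def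
      by (intro has_bochner_integral_add has_bochner_integral_diff has_bochner_integral_mult_right hb)
    then have Eint: "integrable M (E n)" and "expectation (E n) = 2 * c * \<epsilon>
      + (2 * \<tau>\<^sup>2 / c + \<tau>\<^sup>2 / 2) * expectation (\<lambda>\<omega>. (variation n \<omega>)\<^sup>2)
      + (2 * (\<tau>\<^sup>2 * L\<^sup>2) / c - (1 - \<alpha>) / 2) * expectation (\<lambda>\<omega>. (spread n \<omega>)\<^sup>2)"
      by (simp_all only: has_bochner_integral_iff mult_zero_right add_0_right diff_zero)
    note this(2)
    also have "\<dots> \<le> 2 * c * \<epsilon> + (2 * \<tau>\<^sup>2 / c + \<tau>\<^sup>2 / 2) * (L\<^sup>2 * expectation (\<lambda>\<omega>. (spread n \<omega>)\<^sup>2))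
      + (2 * (\<tau>\<^sup>2 * L\<^sup>2) / c - (1 - \<alpha>) / 2) * expectation (\<lambda>\<omega>. (spread n \<omega>)\<^sup>2)"
      using fv(2) c by (intro add_right_mono add_left_mono mult_left_mono) auto
    also have "\<dots> = 2 * c * \<epsilon> + (4 * (\<tau>\<^sup>2 * L\<^sup>2) / c + (\<tau>\<^sup>2 * L\<^sup>2) / 2 - (1 - \<alpha>) / 2) * expectation (\<lambda>\<omega>. (spread n \<omega>)\<^sup>2)"
      by (simp add: algebra_simps add_divide_distrib)
    \<comment> \<open>Here \<open>4/c\<close> combines \<open>|v|\<^sup>2 \<le> 2 |\<Delta>|\<^sup>2 + 2 L\<^sup>2 |zh - w|\<^sup>2\<close> with the bound on the mean of \<open>|\<Delta>|\<^sup>2\<close>.\<close>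
    also have "4 * (\<tau>\<^sup>2 * L\<^sup>2) / c = (1 - \<alpha>) * ((1 - \<gamma>\<^sup>2) / 2)"
      unfolding step_size c_def using \<gamma> \<gamma>2 by (simp add: field_simps)
    also have "(1 - \<alpha>) * ((1 - \<gamma>\<^sup>2) / 2) + (\<tau>\<^sup>2 * L\<^sup>2) / 2 - (1 - \<alpha>) / 2 = 0"
      unfolding step_size by (simp add: algebra_simps diff_divide_distrib)
    finally show "expectation (E n) \<le> 2 * c * \<epsilon>" by simp
    show "integrable M (E n)" by (rule Eint)
  qed
  show ?thesis
  proof (intro exI[of _ B] conjI ballI)
    show "integrable M B" unfolding B_def using E(1) by simp
    have "expectation B = (\<alpha> + real K * (1 - \<alpha>) + c) * R + (\<Sum>n<S * K. expectation (E n))"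
      unfolding B_def using E(1) by (simp add: prob_space)
    also have "(\<Sum>n<S * K. expectation (E n)) \<le> real (S * K) * (2 * c * \<epsilon>)"
      using sum_bounded_above[of "{..<S * K}" "\<lambda>n. expectation (E n)" "2 * c * \<epsilon>"] E(2) by simp
    finally show "expectation B \<le> (\<alpha> + real K * (1 - \<alpha>) + c) * R + real (S * K) * (2 * c * \<epsilon>)" by simp
    fix \<omega> u assume \<omega>: "\<omega> \<in> space M" and u: "u \<in> C \<inter> eff_dom g"
    let ?P = "\<lambda>n. \<tau> * blinfun_apply (err n \<omega>) (half n \<omega> - u) + \<tau>\<^sup>2 / 2 * (variation n \<omega>)\<^sup>2 - (1 - \<alpha>) / 2 * (spread n \<omega>)\<^sup>2"
    have "\<tau> * real (S * K) * (blinfun_apply (F u) (zS \<omega> - u) + gR (zS \<omega>) - gR u)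
        \<le> (\<alpha> + real K * (1 - \<alpha>)) * D u z0 + (\<Sum>n<S * K. ?P n)"
      using mp_run.gap_bound[OF run[OF \<omega>] F_mono S, of u] u
      unfolding zS_def sum_double_index half_def snapshot_def sample_def err_def variation_def spread_def
      by simp
    also have "(\<alpha> + real K * (1 - \<alpha>)) * D u z0 \<le> (\<alpha> + real K * (1 - \<alpha>)) * R"
      using R[OF u] \<alpha>_range by (intro mult_left_mono) auto
    also have "(\<Sum>n<S * K. ?P n) = - \<tau> * (\<Sum>n<S * K. blinfun_apply (err n \<omega>) (u - z0))
        + (\<Sum>n<S * K. \<tau> * blinfun_apply (err n \<omega>) (half n \<omega> - z0) + \<tau>\<^sup>2 / 2 * (variation n \<omega>)\<^sup>2 - (1 - \<alpha>) / 2 * (spread n \<omega>)\<^sup>2)"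
      unfolding sum_distrib_left sum.distrib[symmetric]
      by (intro sum.cong refl) (simp add: blinfun.diff_right algebra_simps)
    also have "\<dots> \<le> c * R + (\<Sum>n<S * K. 2 * c * \<epsilon> - \<tau> * blinfun_apply (err n \<omega>) (x n \<omega> - z0) + \<tau>\<^sup>2 / c * (norm (err n \<omega>))\<^sup>2)
        + (\<Sum>n<S * K. \<tau> * blinfun_apply (err n \<omega>) (half n \<omega> - z0) + \<tau>\<^sup>2 / 2 * (variation n \<omega>)\<^sup>2 - (1 - \<alpha>) / 2 * (spread n \<omega>)\<^sup>2)"
      using noise[OF u] by (rule add_right_mono)
    also have "\<dots> \<le> c * R + (\<Sum>n<S * K. E n \<omega>)"
    proof -
      have "\<tau>\<^sup>2 / c * (norm (err n \<omega>))\<^sup>2 \<le> \<tau>\<^sup>2 / c * (2 * (variation n \<omega>)\<^sup>2 + 2 * L\<^sup>2 * (spread n \<omega>)\<^sup>2)" for n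
        using norm_err_square_le[OF \<omega>] c by (intro mult_left_mono) auto
      also have "\<tau>\<^sup>2 / c * (2 * (variation n \<omega>)\<^sup>2 + 2 * L\<^sup>2 * (spread n \<omega>)\<^sup>2)
          = 2 * \<tau>\<^sup>2 / c * (variation n \<omega>)\<^sup>2 + 2 * (\<tau>\<^sup>2 * L\<^sup>2) / c * (spread n \<omega>)\<^sup>2" for n
        by (simp add: algebra_simps add_divide_distrib)
      finally have "2 * c * \<epsilon> - \<tau> * blinfun_apply (err n \<omega>) (x n \<omega> - z0) + \<tau>\<^sup>2 / c * (norm (err n \<omega>))\<^sup>2
          + (\<tau> * blinfun_apply (err n \<omega>) (half n \<omega> - z0) + \<tau>\<^sup>2 / 2 * (variation n \<omega>)\<^sup>2 - (1 - \<alpha>) / 2 * (spread n \<omega>)\<^sup>2) \<le> E n \<omega>" for n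
        unfolding E_def distrib_right left_diff_distrib by simp
      then show ?thesis
        unfolding add.assoc sum.distrib[symmetric] by (intro add_left_mono sum_mono) (simp add: add.assoc)
    qed
    finally show "\<tau> * real (S * K) * (blinfun_apply (F u) (zS \<omega> - u) + gR (zS \<omega>) - gR u) \<le> B \<omega>"
      by (simp add: B_def distrib_right)
  qed
qed

end

section \<open>The expected gap\<close>

theorem theorem3p6:
  fixes g h :: "'a::real_normed_vector \<Rightarrow> ereal"
    and F :: "'a \<Rightarrow> ('a \<Rightarrow>\<^sub>L real)"
    and Fo :: "'x \<Rightarrow> 'a \<Rightarrow> ('a \<Rightarrow>\<^sub>L real)"
    and \<Xi> :: "'x measure" and Q :: "'a \<Rightarrow> 'a \<Rightarrow> 'x measure"
    and M :: "'w measure" and G :: "nat \<Rightarrow> 'w measure"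
    and \<xi> :: "nat \<Rightarrow> nat \<Rightarrow> 'w \<Rightarrow> 'x"
    and z zh :: "nat \<Rightarrow> nat \<Rightarrow> 'w \<Rightarrow> 'a" and w wbar :: "nat \<Rightarrow> 'w \<Rightarrow> 'a"
    and z0 :: 'a and C :: "'a set"
    and L \<alpha> \<gamma> \<tau> :: real and K S :: nat
  assumes g: "proper_fun g" "convex_fun g" "lsc_fun g"
    and h: "proper_fun h" "convex_fun h" "lsc_fun h"
    and dom_gh: "eff_dom g \<subseteq> eff_dom h"
    and h_diff: "\<forall>v\<in>dom_subdiff h. \<exists>p. has_gradient h p v"
    and h_sc: "strongly_convex_on 1 (eff_dom g) h"
    and F_mono: "monotone_operator_on (eff_dom g) F"
    and sol: "vi_solutions F g \<noteq> {}"
    and L_pos: "L > 0"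
    and F_lip: "variable_lipschitz_oracle L (eff_dom g) \<Xi> Q Fo F"
    and \<alpha>: "0 \<le> \<alpha>" "\<alpha> < 1"
    and \<gamma>: "0 < \<gamma>" "\<gamma> < 1"
    and \<tau>: "\<tau> = sqrt (1 - \<alpha>) / L * \<gamma>"
    and K_pos: "K > 0" and S_pos: "S > 0"
    and z0: "z0 \<in> eff_dom g" "z0 \<in> dom_subdiff h"
    and C: "compact C"
    and process: "mirror_prox_vr_process M G \<Xi> Q g h F Fo \<alpha> \<tau> K z0 \<xi> z zh w wbar"
  shows "ereal_expectation M
           (\<lambda>\<omega>. gap F g C ((1 / (real K * real S)) *\<^sub>R (\<Sum>s<S. \<Sum>k<K. zh s k \<omega>)))
         \<le> ereal (1 / (\<tau> * real K * real S)
                   * (1 + (1 + 8 * \<gamma>\<^sup>2 / (1 - \<gamma>\<^sup>2)) * (\<alpha> + real K * (1 - \<alpha>))))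
           * (SUP z\<in>C \<inter> eff_dom g. bregman h z z0)"
proof -
  have \<tau>_pos: "\<tau> > 0" using \<tau> \<alpha> \<gamma> L_pos by simp
  interpret mp_process g h F Fo \<Xi> Q M G \<xi> z zh w wbar z0 L \<alpha> \<tau> K
    using assms \<tau>_pos by unfold_locales auto
  let ?T = "C \<inter> eff_dom g" and ?N = "real K * real S"
  let ?zS = "\<lambda>\<omega>. (1 / ?N) *\<^sub>R (\<Sum>s<S. \<Sum>k<K. zh s k \<omega>)"
  let ?X = "\<lambda>\<omega>. gap F g C (?zS \<omega>)"
  let ?c = "8 * \<gamma>\<^sup>2 / (1 - \<gamma>\<^sup>2)" and ?\<kappa> = "\<alpha> + real K * (1 - \<alpha>)"
  have N: "?N > 0" using K_pos S_pos by simp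
  have "\<gamma>\<^sup>2 < 1" using \<gamma> by (simp add: power_less_one_iff)
  then have c: "?c > 0" using \<gamma> by simp
  have \<kappa>: "?\<kappa> \<ge> 1"
  proof -
    have "1 - \<alpha> \<le> real K * (1 - \<alpha>)" using K_pos \<alpha> by simp
    then show ?thesis by simp
  qed
  have coeff: "0 < 1 / (\<tau> * real K * real S) * (1 + (1 + ?c) * ?\<kappa>)"
  proof (rule mult_pos_pos)
    have "0 \<le> (1 + ?c) * ?\<kappa>" using c \<kappa> by (intro mult_nonneg_nonneg) linarith+
    then show "0 < 1 + (1 + ?c) * ?\<kappa>" by linarith
  qed (use \<tau>_pos K_pos S_pos in simp)
  have step_size: "\<tau>\<^sup>2 * L\<^sup>2 = (1 - \<alpha>) * \<gamma>\<^sup>2"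
    using L_pos \<alpha> by (simp add: \<tau> power_mult_distrib power_divide)
  have D_ereal: "bregman h u z0 = ereal (D u z0)" if "u \<in> ?T" for u
    using that dom_gh z0(2) by (intro bregman_eq) auto
  show ?thesis
  proof (cases "?T = {}")
    case True
    \<comment> \<open>The right-hand side is \<open>-\<infinity>\<close> as well, being a positive multiple of an empty supremum.\<close>
    have "ereal_expectation M ?X = -\<infinity>"
      by (simp add: ereal_expectation_def gap_def True bot_ereal_def e2ennreal_neg
        emeasure_space_1 zero_ennreal.rep_eq)
    then show ?thesis by simp
  next
    case ne: False
    let ?sup = "SUP u\<in>?T. bregman h u z0"
    obtain u0 where u0: "u0 \<in> ?T" using ne by blast
    have sup0: "0 \<le> ?sup"
    proof -
      have "0 \<le> D u0 z0" using u0 dom_gh by (intro D_nonneg z0(2)) auto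
      then show ?thesis using u0 by (intro SUP_upper2[OF u0]) (simp add: D_ereal)
    qed
    show ?thesis
    proof (cases "?sup = \<infinity>")
      case True
      have "ereal a * \<infinity> = \<infinity>" if "0 < a" for a :: real
        using that by simp
      from this[OF coeff] show ?thesis unfolding True by (simp only: ereal_less_eq)
    next
      case False
      then obtain R where R: "?sup = ereal R" "0 \<le> R"
        using sup0 by (cases ?sup) auto
      have DR: "D u z0 \<le> R" if "u \<in> ?T" for u
        using SUP_upper[OF that, of "\<lambda>u. bregman h u z0"] D_ereal[OF that] R(1) by simp
      let ?a = "1 / (\<tau> * real K * real S) * (1 + (1 + ?c) * ?\<kappa>)"
      have main: "ereal_expectation M ?X \<le> ereal (?a * R) + ereal e" if e: "e > 0" for e
      proof -
        \<comment> \<open>The approximation costs \<open>2 c \<epsilon>\<close> per step, which becomes \<open>e\<close> after division by \<open>\<tau> K S\<close>.\<close>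
        define \<epsilon> where "\<epsilon> = e * \<tau> / (2 * ?c)"
        have \<epsilon>: "\<epsilon> > 0" unfolding \<epsilon>_def
          by (rule divide_pos_pos[OF mult_pos_pos[OF e \<tau>_pos] mult_pos_pos[OF zero_less_numeral c]])
        obtain B where B: "integrable M B"
          "expectation B \<le> (?\<kappa> + ?c) * R + real (S * K) * (2 * ?c * \<epsilon>)"
          "\<And>\<omega> u. \<omega> \<in> space M \<Longrightarrow> u \<in> ?T \<Longrightarrow>
            \<tau> * real (S * K) * (blinfun_apply (F u) (?zS \<omega> - u) + gR (?zS \<omega>) - gR u) \<le> B \<omega>"
          using gap_majorant[OF C ne DR S_pos \<epsilon> \<gamma> step_size] by blast
        let ?B = "\<lambda>\<omega>. B \<omega> / (\<tau> * ?N)"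
        have "?X \<omega> \<le> ereal (?B \<omega>)" if \<omega>: "\<omega> \<in> space M" for \<omega>
          unfolding gap_def
        proof (rule SUP_least)
          fix u assume u: "u \<in> ?T"
          have "?zS \<omega> \<in> eff_dom g" by (rule mp_run.average_dom(1)[OF run[OF \<omega>] S_pos])
          then have "ereal (blinfun_apply (F u) (?zS \<omega> - u)) + g (?zS \<omega>) - g u
              = ereal (blinfun_apply (F u) (?zS \<omega> - u) + gR (?zS \<omega>) - gR u)"
            using u by (simp add: g_real)
          moreover have "blinfun_apply (F u) (?zS \<omega> - u) + gR (?zS \<omega>) - gR u \<le> ?B \<omega>"
            using B(3)[OF \<omega> u] \<tau>_pos N by (simp add: pos_le_divide_eq mult_ac)
          ultimately show "ereal (blinfun_apply (F u) (?zS \<omega> - u)) + g (?zS \<omega>) - g u \<le> ereal (?B \<omega>)"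
            by (simp only: ereal_less_eq)
        qed
        then have "ereal_expectation M ?X \<le> ereal (expectation ?B)"
          using B(1) by (intro ereal_expectation_le) auto
        also have "expectation ?B \<le> ?a * R + e"
        proof -
          have "expectation ?B \<le> ((?\<kappa> + ?c) * R + real (S * K) * (2 * ?c * \<epsilon>)) / (\<tau> * ?N)"
            using B(2) \<tau>_pos N by (simp add: divide_right_mono)
          also have "\<dots> = (?\<kappa> + ?c) * R / (\<tau> * ?N) + e"
          proof -
            have "2 * ?c * \<epsilon> = e * \<tau>" unfolding \<epsilon>_def using c by (metis nonzero_eq_divide_eq mult.commute less_irrefl mult_eq_0_iff zero_neq_numeral)
            then have "real (S * K) * (2 * ?c * \<epsilon>) = e * (\<tau> * ?N)" by simp
            moreover have "\<tau> * ?N \<noteq> 0" using \<tau>_pos N by (metis less_irrefl mult_pos_pos)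
            ultimately show ?thesis
              by (simp only: add_divide_distrib nonzero_mult_div_cancel_right not_False_eq_True)
          qed
          also have "(?\<kappa> + ?c) * R / (\<tau> * ?N) \<le> ?a * R"
          proof -
            \<comment> \<open>This uses \<open>?\<kappa> \<ge> 1\<close>, that is, \<open>K \<ge> 1\<close>.\<close>
            have "?c * 1 \<le> ?c * ?\<kappa>" using c \<kappa> by (intro mult_left_mono) auto
            then have "?\<kappa> + ?c \<le> 1 + (1 + ?c) * ?\<kappa>" by (simp add: distrib_right)
            then have "(?\<kappa> + ?c) * R / (\<tau> * ?N) \<le> (1 + (1 + ?c) * ?\<kappa>) * R / (\<tau> * ?N)"
              using R(2) \<tau>_pos N by (intro divide_right_mono mult_right_mono) auto
            then show ?thesis by (simp add: mult.assoc)
          qed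
          finally show ?thesis by simp
        qed
        finally show ?thesis by simp
      qed
      have "ereal_expectation M ?X \<le> ereal (?a * R)"
        by (rule ereal_le_epsilon2) (use main in blast)
      then show ?thesis by (simp add: R(1))
    qed
  qed
qed

end
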